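(* Let $(\Omega,\mathcal A,(p_\theta\cdot\mu)_{\theta\in\Theta})$, $\Theta\subseteq\mathbb R$ (usual order), be a statistical model with monotone likelihood ratio with respect to the real statistic $T$. Let $\theta_0\in\Theta$ with $\theta_0\neq\inf\Theta$, and consider the one-sided hypotheses $\Theta_0=\Theta\cap\{\theta\ge\theta_0\}$ and $\Theta_1=\Theta\cap\{\theta<\theta_0\}$. Let $K(T)$ be the essential statistic, $Q^\omega_\theta$ the votes, and $Q^\omega_{\Theta_0},Q^\omega_{\Theta_1}$ the most favourable votes associated with $\{\Theta_1,\Theta_0\}$ (built from a normalized family). Then: (1) For every $\omega$, $Q^\omega_{\Theta_0}(\{0\})=Q^\omega_{\theta_0}(\{0\})$, and this number is the minimal rejection level $\alpha_m(\omega)$ of $H_0:\theta\ge\theta_0$ against $H_1:\theta<\theta_0$ for the uniformly most powerful tests built with the essential statistic $K(T)$. (2) If the hypotheses are adjacent, i.e. $Q^\omega_{\Theta_0}=Q^\omega_{\Theta_1}$ for almost every $\omega$, then $Q^\omega_{\Theta_1}(\{1\})=Q^\omega_{\theta_0}(\{1\})$ almost surely, and $Q^\omega_{\Theta_1}(\{1\})$ is the minimal rejection level $\alpha'_m(\omega)$ of $H_0:\theta<\theta_0$ against $H_1:\theta\ge\theta_0$.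
   Context: "Almost surely" / "almost every $\omega$" means outside an event that is $P_\theta$-null for every $\theta\in\Theta$, where $P_\theta=p_\theta\cdot\mu$ (fixed densities $p_\theta\ge 0$). "Increasing" means nondecreasing. Monotone likelihood ratio. $\Theta$ is totally ordered; $T:\Omega\to\mathbb R$ is measurable, and for all $\theta'<\theta''$ in $\Theta$ there is an increasing $h_{(\theta'',\theta')}:\mathbb R\to[0,+\infty]$ with $p_{\theta''}/p_{\theta'}=h_{(\theta'',\theta')}(T)$ wherever the ratio is defined, i.e. outside $\{p_{\theta'}=p_{\theta''}=0\}$ (the ratio is $+\infty$ where $p_{\theta'}=0<p_{\theta''}$). One-sided hypotheses: $\Theta=\Theta_1+\Theta_0$, both nonempty, every element of $\Theta_1$ smaller than every element of $\Theta_0$. Normalized family. $D_i=]-\infty,t)$ is the largest (open or closed, possibly empty) lower half-line of $\mathbb R$ such that $p_\theta=0$ on $T^{-1}(D_i)$ for all $\theta\in\Theta_0$; $D_s=(t,+\infty[$ is the largest upper half-line such that $p_\theta=0$ on $T^{-1}(D_s)$ for all $\theta\in\Theta_1$. A family of increasing functions $h_{(\theta_0,\theta_1)}:\mathbb R\to[0,+\infty]$, $(\theta_0,\theta_1)\in\Theta_0\times\Theta_1$, with $p_{\theta_0}/p_{\theta_1}=h_{(\theta_0,\theta_1)}(T)$ wherever the ratio is defined, is normalized if each member (i) is constant on every interval $I\subseteq\mathbb R-(D_i\cup D_s)$ such that $p_{\theta_0}=p_{\theta_1}=0$ on $T^{-1}(I)$, (ii) equals $+\infty$ on $D_s$, (iii)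 vanishes on $D_i-D_s$. Such a family always exists. Simple test functions. For $(\theta_0,\theta_1)$ put $K_{(\theta_0,\theta_1)}=h_{(\theta_0,\theta_1)}(T)$ and $\phi^{(\theta_0,\theta_1)}_{(k,\beta)}=\mathbf 1_{\{K_{(\theta_0,\theta_1)}<k\}}+\beta\mathbf 1_{\{K_{(\theta_0,\theta_1)}=k\}}$ for $(k,\beta)\in\{(0,1)\}\cup(]0,\infty[\times\{0,1\})\cup\{(\infty,0)\}$; $\Phi_s^{(\theta_0,\theta_1)}$ is the set of these and $\Delta_s=\bigcup\Phi_s^{(\theta_0,\theta_1)}$ over $\Theta_0\times\Theta_1$. Let $f_{(t,u)}=\mathbf 1_{\{T<t\}}+u\mathbf 1_{\{T=t\}}$ and $F=\{f_{(t,u)}:(t,u)\in\{(-\infty,1)\}\cup(\mathbb R\times\{0,1\})\cup\{(+\infty,0)\}\}$, totally ordered (lexicographic order of $(t,u)$, i.e. pointwise order) with the order topology (which is also the topology of pointwise convergence); $\Delta_s\subseteq F$, and $\overline{\Delta_s}$ is its closure in $F$. Essential statistic. Add formally $f_{(-\infty,0)}$ below and $f_{(+\infty,1)}$ above $F$. For $t\in\mathbb R$ let $f_{(a_t,u_t)}=\sup\big(\{f\in\overline{\Delta_s}:f\le f_{(t,0)}\}\cup\{f_{(-\infty,0)}\}\big)$, $f_{(b_t,v_t)}=\inf\big(\{f\in\overline{\Delta_s}:f\ge f_{(t,1)}\}\cup\{f_{(+\infty,1)}\}\big)$, and $K(t)=-\infty$ if $(a_t,u_t)=(-\infty,0)$;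 $K(t)=b_t-1$ if $(a_t,u_t)=(-\infty,1)$; $K(t)=(a_t+b_t)/2$ if $-\infty<a_t\le b_t<+\infty$; $K(t)=a_t+1$ if $(b_t,v_t)=(+\infty,0)$ and $a_t>-\infty$; $K(t)=+\infty$ if $(b_t,v_t)=(+\infty,1)$. $K(T)$ is the essential statistic, with mean distribution function $G_\theta(k)=\frac12[P_\theta(K(T)<k)+P_\theta(K(T)\le k)]$ under $P_\theta$. Votes. $Q_\theta^\omega$ is the probability on $\{0,1\}$ with $Q_\theta^\omega(\{1\})=1$ if $T(\omega)\in D_i-D_s$, $=1-G_\theta(K(T(\omega)))$ if $T(\omega)\in\mathbb R-(D_i\cup D_s)$, $=0$ if $T(\omega)\in D_s$. Most favourable votes: $Q^\omega_{\Theta_0}$, $Q^\omega_{\Theta_1}$ are the probabilities on $\{0,1\}$ with $Q^\omega_{\Theta_0}(\{0\})=\sup_{\theta\in\Theta_0}Q^\omega_\theta(\{0\})$ and $Q^\omega_{\Theta_1}(\{1\})=\sup_{\theta\in\Theta_1}Q^\omega_\theta(\{1\})$. Minimal rejection levels. For $H_0:\theta\ge\theta_0$ the tests built with $K(T)$ are $\mathbf 1_{\{K(T)<c\}}+\gamma\mathbf 1_{\{K(T)=c\}}$ ($c\in[-\infty,+\infty]$, $\gamma\in[0,1]$) that are $\ge\mathbf 1_{D_i-D_s}(T)$; they are uniformly most powerful at their level. The minimal rejection level (p-value) is taken halfway between the least level of such tests rejecting at $\omega$ with probability $1$ and the least level of such tests rejecting at $\omega$ with positive probability: $\alpha_m(\omega)=P_{\theta_0}(K(T)<K(T(\omega)))+\frac12P_{\theta_0}(K(T)=K(T(\omega)))$,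 with value $0$ if $T(\omega)\in D_i-D_s$, and with the convention $\alpha_m(\omega)=1$ if $T(\omega)\in D_s$ (the non-rejection region of the test $1-\mathbf 1_{D_s}(T)$, which has power $1$ on $\Theta_1$). For $H_0:\theta<\theta_0$ the tests are $\mathbf 1_{\{K(T)>c\}}+\gamma\mathbf 1_{\{K(T)=c\}}$ with level $\sup_{\theta\in\Theta_1}E_\theta$ and $\alpha'_m(\omega)=\sup_{\theta\in\Theta_1}[1-G_\theta(K(T(\omega)))]$ if $T(\omega)\notin D_i\cup D_s$, $0$ if $T(\omega)\in D_s$, and by convention $1$ if $T(\omega)\in D_i-D_s$. *)

theory Defs
  imports "HOL-Probability.Probability"
begin

section \<open>Statistical models and tests\<close>

definition stat_model :: "'a measure \<Rightarrow> 'i set \<Rightarrow> ('i \<Rightarrow> 'a \<Rightarrow> real) \<Rightarrow> bool" where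
  "stat_model M \<Theta> p \<longleftrightarrow>
     (\<forall>\<theta>\<in>\<Theta>. p \<theta> \<in> borel_measurable M \<and> (\<forall>\<omega>\<in>space M. 0 \<le> p \<theta> \<omega>) \<and>
        prob_space (density M (\<lambda>\<omega>. ennreal (p \<theta> \<omega>))))"

definition law :: "'a measure \<Rightarrow> ('i \<Rightarrow> 'a \<Rightarrow> real) \<Rightarrow> 'i \<Rightarrow> 'a measure" where
  "law M p \<theta> = density M (\<lambda>\<omega>. ennreal (p \<theta> \<omega>))"

text \<open>One exceptional event serves all parameters, which may be uncountably many; hence
  this is not a family of \<^const>\<open>almost_everywhere\<close> statements.\<close>

definition almost_surely ::
  "'a measure \<Rightarrow> 'i set \<Rightarrow> ('i \<Rightarrow> 'a \<Rightarrow> real) \<Rightarrow> ('a \<Rightarrow> bool) \<Rightarrow> bool" where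
  "almost_surely M \<Theta> p S \<longleftrightarrow>
     (\<exists>N\<in>sets M. (\<forall>\<theta>\<in>\<Theta>. emeasure (law M p \<theta>) N = 0) \<and> (\<forall>\<omega>\<in>space M - N. S \<omega>))"

definition is_test :: "'a measure \<Rightarrow> ('a \<Rightarrow> real) \<Rightarrow> bool" where
  "is_test M \<phi> \<longleftrightarrow> \<phi> \<in> borel_measurable M \<and> (\<forall>\<omega>\<in>space M. 0 \<le> \<phi> \<omega> \<and> \<phi> \<omega> \<le> 1)"

definition level :: "'a measure \<Rightarrow> ('i \<Rightarrow> 'a \<Rightarrow> real) \<Rightarrow> 'i set \<Rightarrow> ('a \<Rightarrow> real) \<Rightarrow> real" where
  "level M p H \<phi> = (SUP \<theta>\<in>H. integral\<^sup>L (law M p \<theta>) \<phi>)"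

text \<open>\<open>H\<close> is the null hypothesis and \<open>A\<close> the alternative.\<close>

definition unif_most_powerful ::
  "'a measure \<Rightarrow> ('i \<Rightarrow> 'a \<Rightarrow> real) \<Rightarrow> 'i set \<Rightarrow> 'i set \<Rightarrow> ('a \<Rightarrow> real) \<Rightarrow> bool" where
  "unif_most_powerful M p H A \<phi> \<longleftrightarrow> is_test M \<phi> \<and>
     (\<forall>\<psi>. is_test M \<psi> \<and> level M p H \<psi> \<le> level M p H \<phi> \<longrightarrow>
        (\<forall>\<theta>\<in>A. integral\<^sup>L (law M p \<theta>) \<psi> \<le> integral\<^sup>L (law M p \<theta>) \<phi>))"

text \<open>Rejection at \<open>\<omega>\<close> with positive probability: the least level is in general an infimum
  that is not attained.\<close>

definition halfway_level ::
  "'a measure \<Rightarrow> ('i \<Rightarrow> 'a \<Rightarrow> real) \<Rightarrow> 'i set \<Rightarrow> ('a \<Rightarrow> real) set \<Rightarrow> 'a \<Rightarrow> real" where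
  "halfway_level M p H tests \<omega> =
     (Inf (level M p H ` {\<phi>\<in>tests. \<phi> \<omega> = 1}) + Inf (level M p H ` {\<phi>\<in>tests. 0 < \<phi> \<omega>})) / 2"


section \<open>Monotone likelihood ratio and normalized families\<close>

text \<open>In \<^typ>\<open>ennreal\<close>, \<open>x / 0 = \<infinity>\<close> for \<open>x > 0\<close>.\<close>

definition monotone_ratio ::
  "'a measure \<Rightarrow> ('i \<Rightarrow> 'a \<Rightarrow> real) \<Rightarrow> ('a \<Rightarrow> real) \<Rightarrow> 'i \<Rightarrow> 'i \<Rightarrow> (real \<Rightarrow> ennreal) \<Rightarrow> bool" where
  "monotone_ratio M p T \<theta> \<theta>' g \<longleftrightarrow> mono g \<and>
     (\<forall>\<omega>\<in>space M. \<not> (p \<theta> \<omega> = 0 \<and> p \<theta>' \<omega> = 0) \<longrightarrow>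
        ennreal (p \<theta> \<omega>) / ennreal (p \<theta>' \<omega>) = g (T \<omega>))"

definition monotone_likelihood_ratio ::
  "'a measure \<Rightarrow> 'i::linorder set \<Rightarrow> ('i \<Rightarrow> 'a \<Rightarrow> real) \<Rightarrow> ('a \<Rightarrow> real) \<Rightarrow> bool" where
  "monotone_likelihood_ratio M \<Theta> p T \<longleftrightarrow> T \<in> borel_measurable M \<and>
     (\<forall>\<theta>'\<in>\<Theta>. \<forall>\<theta>''\<in>\<Theta>. \<theta>' < \<theta>'' \<longrightarrow> (\<exists>g. monotone_ratio M p T \<theta>'' \<theta>' g))"

definition vanishes_on ::
  "'a measure \<Rightarrow> ('i \<Rightarrow> 'a \<Rightarrow> real) \<Rightarrow> ('a \<Rightarrow> real) \<Rightarrow> 'i set \<Rightarrow> real set \<Rightarrow> bool" where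
  "vanishes_on M p T H I \<longleftrightarrow> (\<forall>\<theta>\<in>H. \<forall>\<omega>\<in>space M. T \<omega> \<in> I \<longrightarrow> p \<theta> \<omega> = 0)"

text \<open>Half-lines on which the densities vanish are closed under union, so the union of all of
  them is the largest one.  Lower half-lines are the downward closed sets (open, closed or
  empty; the whole line is also admitted, but probability densities cannot all vanish there).\<close>

definition D_inf ::
  "'a measure \<Rightarrow> ('i \<Rightarrow> 'a \<Rightarrow> real) \<Rightarrow> ('a \<Rightarrow> real) \<Rightarrow> 'i set \<Rightarrow> real set" where
  "D_inf M p T \<Theta>\<^sub>0 = \<Union>{D. (\<forall>x\<in>D. \<forall>y\<le>x. y \<in> D) \<and> vanishes_on M p T \<Theta>\<^sub>0 D}"

definition D_sup ::
  "'a measure \<Rightarrow> ('i \<Rightarrow> 'a \<Rightarrow> real) \<Rightarrow> ('a \<Rightarrow> real) \<Rightarrow> 'i set \<Rightarrow> real set" where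
  "D_sup M p T \<Theta>\<^sub>1 = \<Union>{D. (\<forall>x\<in>D. \<forall>y\<ge>x. y \<in> D) \<and> vanishes_on M p T \<Theta>\<^sub>1 D}"

definition normalized_family ::
  "'a measure \<Rightarrow> ('i \<Rightarrow> 'a \<Rightarrow> real) \<Rightarrow> ('a \<Rightarrow> real) \<Rightarrow> 'i set \<Rightarrow> 'i set \<Rightarrow>
     ('i \<Rightarrow> 'i \<Rightarrow> real \<Rightarrow> ennreal) \<Rightarrow> bool" where
  "normalized_family M p T \<Theta>\<^sub>0 \<Theta>\<^sub>1 h \<longleftrightarrow>
     (let Di = D_inf M p T \<Theta>\<^sub>0; Ds = D_sup M p T \<Theta>\<^sub>1 in
      \<forall>\<theta>\<^sub>0\<in>\<Theta>\<^sub>0. \<forall>\<theta>\<^sub>1\<in>\<Theta>\<^sub>1.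
        monotone_ratio M p T \<theta>\<^sub>0 \<theta>\<^sub>1 (h \<theta>\<^sub>0 \<theta>\<^sub>1) \<and>
        (\<forall>I. is_interval I \<and> I \<subseteq> UNIV - (Di \<union> Ds) \<and> vanishes_on M p T {\<theta>\<^sub>0, \<theta>\<^sub>1} I \<longrightarrow>
           (\<forall>x\<in>I. \<forall>y\<in>I. h \<theta>\<^sub>0 \<theta>\<^sub>1 x = h \<theta>\<^sub>0 \<theta>\<^sub>1 y)) \<and>
        (\<forall>x\<in>Ds. h \<theta>\<^sub>0 \<theta>\<^sub>1 x = \<infinity>) \<and>
        (\<forall>x\<in>Di - Ds. h \<theta>\<^sub>0 \<theta>\<^sub>1 x = 0))"


section \<open>The ordered space of half-line indicators\<close>

text \<open>\<open>Cut t u\<close> stands for \<open>f\<^bsub>(t,u)\<^esub>\<close>, with \<open>True\<close>, \<open>False\<close> for \<open>u = 1\<close>, \<open>u = 0\<close>, in the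
  lexicographic order and its order topology.  The type also contains the two formal elements
  \<open>Cut (-\<infinity>) False\<close> (bottom) and \<open>Cut \<infinity> True\<close> (top).\<close>

datatype cut = Cut (pos: ereal) (incl: bool)

instantiation cut :: complete_linorder
begin

definition "x \<le> y \<longleftrightarrow> pos x < pos y \<or> (pos x = pos y \<and> incl x \<le> incl y)"
definition "x < y \<longleftrightarrow> pos x < pos y \<or> (pos x = pos y \<and> incl x < incl y)"
definition "sup x y = (if x \<le> y then y else x)" for x y :: cut
definition "inf x y = (if x \<le> y then x else y)" for x y :: cut
definition "bot = Cut (-\<infinity>) False"
definition "top = Cut \<infinity> True"
definition "Sup S = Cut (SUP x\<in>S. pos x) (Cut (SUP x\<in>S. pos x) True \<in> S)"
definition "Inf S = Cut (INF x\<in>S. pos x) (Cut (INF x\<in>S. pos x) False \<notin> S)"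

instance
proof
  fix x y z :: cut and S :: "cut set"
  show "(x < y) = (x \<le> y \<and> \<not> y \<le> x)" "x \<le> x" "x \<le> y \<or> y \<le> x"
    by (auto simp: less_eq_cut_def less_cut_def)
  show tr: "x \<le> z" if "x \<le> y" "y \<le> z"
    using that by (auto simp: less_eq_cut_def)
  show "x = y" if "x \<le> y" "y \<le> x"
    using that by (auto simp: less_eq_cut_def cut.expand)
  show "inf x y \<le> x" "inf x y \<le> y" "x \<le> sup x y" "y \<le> sup x y"
    by (auto simp: inf_cut_def sup_cut_def less_eq_cut_def)
  show "x \<le> inf y z" if "x \<le> y" "x \<le> z"
    using that by (auto simp: inf_cut_def)
  show "sup y z \<le> x" if "y \<le> x" "z \<le> x"
    using that by (auto simp: sup_cut_def)
  show "Sup ({}::cut set) = bot" "Inf ({}::cut set) = top"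
    by (auto simp: Sup_cut_def Inf_cut_def bot_cut_def top_cut_def bot_ereal_def top_ereal_def)
  show "x \<le> Sup S" if "x \<in> S"
  proof -
    have *: "pos x \<le> (SUP x\<in>S. pos x)" using that by (rule SUP_upper)
    show ?thesis
    proof (cases "pos x = (SUP x\<in>S. pos x)")
      case True
      have "Cut (SUP x\<in>S. pos x) True \<in> S" if "incl x"
        using \<open>x \<in> S\<close> that True by (metis (full_types) cut.collapse)
      then show ?thesis using True by (auto simp: less_eq_cut_def Sup_cut_def)
    next
      case False
      then show ?thesis using * by (auto simp: less_eq_cut_def Sup_cut_def)
    qed
  qed
  show "Inf S \<le> x" if "x \<in> S"
  proof -
    have *: "(INF x\<in>S. pos x) \<le> pos x" using that by (rule INF_lower)
    show ?thesis
    proof (cases "pos x = (INF x\<in>S. pos x)")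
      case True
      have "Cut (INF x\<in>S. pos x) False \<in> S" if "\<not> incl x"
        using \<open>x \<in> S\<close> that True by (metis (full_types) cut.collapse)
      then show ?thesis using True by (auto simp: less_eq_cut_def Inf_cut_def)
    next
      case False
      then show ?thesis using * by (auto simp: less_eq_cut_def Inf_cut_def)
    qed
  qed
  show "Sup S \<le> x" if le: "\<And>y. y \<in> S \<Longrightarrow> y \<le> x"
  proof -
    have "(SUP x\<in>S. pos x) \<le> pos x"
      using le by (intro SUP_least) (auto simp: less_eq_cut_def order.order_iff_strict)
    then show ?thesis
      using le by (fastforce simp: less_eq_cut_def Sup_cut_def)
  qed
  show "x \<le> Inf S" if le: "\<And>y. y \<in> S \<Longrightarrow> x \<le> y"
  proof -
    have "pos x \<le> (INF x\<in>S. pos x)"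
      using le by (intro INF_greatest) (auto simp: less_eq_cut_def order.order_iff_strict)
    then show ?thesis
      using le by (fastforce simp: less_eq_cut_def Inf_cut_def)
  qed
qed

end

instantiation cut :: linorder_topology
begin

definition open_cut :: "cut set \<Rightarrow> bool" where
  "open_cut = generate_topology (range (\<lambda>a. {..<a}) \<union> range (\<lambda>a. {a<..}))"

instance
  by standard (rule open_cut_def)

end

text \<open>The test \<open>f\<^bsub>(t,u)\<^esub> = 1\<^bsub>{T<t}\<^esub> + u 1\<^bsub>{T=t}\<^esub>\<close>, and likewise the simple test functions below,
  as functions of the value \<open>x\<close> of \<open>T\<close>.  On the set \<open>F\<close>, distinct cuts give distinct functions
  and the lexicographic order is the pointwise order.\<close>

definition cut_fun :: "cut \<Rightarrow> real \<Rightarrow> real" where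
  "cut_fun c x = (if ereal x < pos c then 1 else if ereal x = pos c then of_bool (incl c) else 0)"

definition F :: "cut set" where
  "F = {Cut (-\<infinity>) True} \<union> {Cut (ereal t) u | t u. True} \<union> {Cut \<infinity> False}"

definition simple_test :: "(real \<Rightarrow> ennreal) \<Rightarrow> ennreal \<Rightarrow> real \<Rightarrow> real \<Rightarrow> real" where
  "simple_test g k \<beta> x = (if g x < k then 1 else if g x = k then \<beta> else 0)"

definition simple_tests ::
  "'i set \<Rightarrow> 'i set \<Rightarrow> ('i \<Rightarrow> 'i \<Rightarrow> real \<Rightarrow> ennreal) \<Rightarrow> (real \<Rightarrow> real) set" where
  "simple_tests \<Theta>\<^sub>0 \<Theta>\<^sub>1 h =
     {simple_test (h \<theta>\<^sub>0 \<theta>\<^sub>1) k \<beta> | \<theta>\<^sub>0 \<theta>\<^sub>1 k \<beta>.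
        \<theta>\<^sub>0 \<in> \<Theta>\<^sub>0 \<and> \<theta>\<^sub>1 \<in> \<Theta>\<^sub>1 \<and> (k, \<beta>) \<in> {(0, 1)} \<union> ({0<..<\<infinity>} \<times> {0, 1}) \<union> {(\<infinity>, 0)}}"

text \<open>\<open>F\<close> is an order-convex part of the type \<^typ>\<open>cut\<close>, so its own order topology is the
  subspace topology and the closure in \<open>F\<close> is obtained by intersection.\<close>

definition closure_simple ::
  "'i set \<Rightarrow> 'i set \<Rightarrow> ('i \<Rightarrow> 'i \<Rightarrow> real \<Rightarrow> ennreal) \<Rightarrow> cut set" where
  "closure_simple \<Theta>\<^sub>0 \<Theta>\<^sub>1 h = closure {c\<in>F. cut_fun c \<in> simple_tests \<Theta>\<^sub>0 \<Theta>\<^sub>1 h} \<inter> F"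


section \<open>Essential statistic and votes\<close>

text \<open>The case \<open>(a\<^sub>t, u\<^sub>t) = (-\<infinity>, 1)\<close> includes \<open>b\<^sub>t = \<infinity>\<close>, where \<open>\<infinity> - 1 = \<infinity>\<close> in \<^typ>\<open>ereal\<close>.\<close>

definition essential ::
  "'i set \<Rightarrow> 'i set \<Rightarrow> ('i \<Rightarrow> 'i \<Rightarrow> real \<Rightarrow> ennreal) \<Rightarrow> real \<Rightarrow> ereal" where
  "essential \<Theta>\<^sub>0 \<Theta>\<^sub>1 h t =
     (let A = Sup ({c \<in> closure_simple \<Theta>\<^sub>0 \<Theta>\<^sub>1 h. c \<le> Cut (ereal t) False} \<union> {Cut (-\<infinity>) False});
          B = Inf ({c \<in> closure_simple \<Theta>\<^sub>0 \<Theta>\<^sub>1 h. Cut (ereal t) True \<le> c} \<union> {Cut \<infinity> True})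
      in if A = Cut (-\<infinity>) False then -\<infinity>
         else if A = Cut (-\<infinity>) True then pos B - 1
         else if pos B < \<infinity> then (pos A + pos B) / 2
         else if B = Cut \<infinity> False then pos A + 1
         else \<infinity>)"

definition mean_cdf ::
  "'a measure \<Rightarrow> ('i \<Rightarrow> 'a \<Rightarrow> real) \<Rightarrow> ('a \<Rightarrow> ereal) \<Rightarrow> 'i \<Rightarrow> ereal \<Rightarrow> real" where
  "mean_cdf M p X \<theta> k =
     1/2 * (measure (law M p \<theta>) {\<omega>\<in>space M. X \<omega> < k} + measure (law M p \<theta>) {\<omega>\<in>space M. X \<omega> \<le> k})"

text \<open>Probabilities on \<open>{0, 1}\<close> are of type \<^typ>\<open>bool pmf\<close>, with \<open>True\<close> for 1 and \<open>False\<close> for 0.\<close>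

definition vote ::
  "'a measure \<Rightarrow> ('i \<Rightarrow> 'a \<Rightarrow> real) \<Rightarrow> ('a \<Rightarrow> real) \<Rightarrow> 'i set \<Rightarrow> 'i set \<Rightarrow>
     ('i \<Rightarrow> 'i \<Rightarrow> real \<Rightarrow> ennreal) \<Rightarrow> 'i \<Rightarrow> 'a \<Rightarrow> bool pmf" where
  "vote M p T \<Theta>\<^sub>0 \<Theta>\<^sub>1 h \<theta> \<omega> =
     (let K = essential \<Theta>\<^sub>0 \<Theta>\<^sub>1 h in
      bernoulli_pmf
        (if T \<omega> \<in> D_sup M p T \<Theta>\<^sub>1 then 0
         else if T \<omega> \<in> D_inf M p T \<Theta>\<^sub>0 then 1
         else 1 - mean_cdf M p (K \<circ> T) \<theta> (K (T \<omega>))))"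

definition most_favourable_0 ::
  "'a measure \<Rightarrow> ('i \<Rightarrow> 'a \<Rightarrow> real) \<Rightarrow> ('a \<Rightarrow> real) \<Rightarrow> 'i set \<Rightarrow> 'i set \<Rightarrow>
     ('i \<Rightarrow> 'i \<Rightarrow> real \<Rightarrow> ennreal) \<Rightarrow> 'a \<Rightarrow> bool pmf" where
  "most_favourable_0 M p T \<Theta>\<^sub>0 \<Theta>\<^sub>1 h \<omega> =
     bernoulli_pmf (1 - (SUP \<theta>\<in>\<Theta>\<^sub>0. pmf (vote M p T \<Theta>\<^sub>0 \<Theta>\<^sub>1 h \<theta> \<omega>) False))"

definition most_favourable_1 ::
  "'a measure \<Rightarrow> ('i \<Rightarrow> 'a \<Rightarrow> real) \<Rightarrow> ('a \<Rightarrow> real) \<Rightarrow> 'i set \<Rightarrow> 'i set \<Rightarrow>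
     ('i \<Rightarrow> 'i \<Rightarrow> real \<Rightarrow> ennreal) \<Rightarrow> 'a \<Rightarrow> bool pmf" where
  "most_favourable_1 M p T \<Theta>\<^sub>0 \<Theta>\<^sub>1 h \<omega> =
     bernoulli_pmf (SUP \<theta>\<in>\<Theta>\<^sub>1. pmf (vote M p T \<Theta>\<^sub>0 \<Theta>\<^sub>1 h \<theta> \<omega>) True)"


section \<open>Tests built with the essential statistic and minimal rejection levels\<close>

definition lower_tests ::
  "'a measure \<Rightarrow> ('i \<Rightarrow> 'a \<Rightarrow> real) \<Rightarrow> ('a \<Rightarrow> real) \<Rightarrow> 'i set \<Rightarrow> 'i set \<Rightarrow>
     ('i \<Rightarrow> 'i \<Rightarrow> real \<Rightarrow> ennreal) \<Rightarrow> ('a \<Rightarrow> real) set" where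
  "lower_tests M p T \<Theta>\<^sub>0 \<Theta>\<^sub>1 h =
     (let K = essential \<Theta>\<^sub>0 \<Theta>\<^sub>1 h in
      {\<phi>. (\<exists>c. \<exists>\<gamma>\<in>{0..1}. \<phi> = (\<lambda>\<omega>. if K (T \<omega>) < c then 1 else if K (T \<omega>) = c then \<gamma> else 0)) \<and>
          (\<forall>\<omega>\<in>space M. indicator (D_inf M p T \<Theta>\<^sub>0 - D_sup M p T \<Theta>\<^sub>1) (T \<omega>) \<le> \<phi> \<omega>)})"

definition upper_tests ::
  "('a \<Rightarrow> real) \<Rightarrow> 'i set \<Rightarrow> 'i set \<Rightarrow> ('i \<Rightarrow> 'i \<Rightarrow> real \<Rightarrow> ennreal) \<Rightarrow> ('a \<Rightarrow> real) set" where
  "upper_tests T \<Theta>\<^sub>0 \<Theta>\<^sub>1 h =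
     (let K = essential \<Theta>\<^sub>0 \<Theta>\<^sub>1 h in
      {\<phi>. \<exists>c. \<exists>\<gamma>\<in>{0..1}. \<phi> = (\<lambda>\<omega>. if K (T \<omega>) > c then 1 else if K (T \<omega>) = c then \<gamma> else 0)})"

text \<open>Minimal rejection levels for the null hypothesis \<open>\<Theta>\<^sub>0\<close> and for the null hypothesis
  \<open>\<Theta>\<^sub>1\<close>; the value 1 is a convention in each case.\<close>

definition min_rejection_level ::
  "'a measure \<Rightarrow> ('i \<Rightarrow> 'a \<Rightarrow> real) \<Rightarrow> ('a \<Rightarrow> real) \<Rightarrow> 'i set \<Rightarrow> 'i set \<Rightarrow>
     ('i \<Rightarrow> 'i \<Rightarrow> real \<Rightarrow> ennreal) \<Rightarrow> 'a \<Rightarrow> real" where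
  "min_rejection_level M p T \<Theta>\<^sub>0 \<Theta>\<^sub>1 h \<omega> =
     (if T \<omega> \<in> D_sup M p T \<Theta>\<^sub>1 then 1
      else halfway_level M p \<Theta>\<^sub>0 (lower_tests M p T \<Theta>\<^sub>0 \<Theta>\<^sub>1 h) \<omega>)"

definition min_rejection_level' ::
  "'a measure \<Rightarrow> ('i \<Rightarrow> 'a \<Rightarrow> real) \<Rightarrow> ('a \<Rightarrow> real) \<Rightarrow> 'i set \<Rightarrow> 'i set \<Rightarrow>
     ('i \<Rightarrow> 'i \<Rightarrow> real \<Rightarrow> ennreal) \<Rightarrow> 'a \<Rightarrow> real" where
  "min_rejection_level' M p T \<Theta>\<^sub>0 \<Theta>\<^sub>1 h \<omega> =
     (if T \<omega> \<in> D_inf M p T \<Theta>\<^sub>0 - D_sup M p T \<Theta>\<^sub>1 then 1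
      else halfway_level M p \<Theta>\<^sub>1 (upper_tests T \<Theta>\<^sub>0 \<Theta>\<^sub>1 h) \<omega>)"

end

theory Submission
  imports Defs
begin

text \<open>The essential statistic \<open>K\<close> separates \<open>s < t\<close> exactly when some ratio \<open>h \<theta> \<theta>'\<close> does, so it is
  monotone and at least as fine as every ratio.  Hence tests that decrease in \<open>K(T)\<close> are
  Neyman--Pearson tests of \<open>\<theta>\<^sub>0\<close> against each \<open>\<theta>'\<close> in the alternative, provided they reject where
  \<open>h \<theta>\<^sub>0 \<theta>'\<close> vanishes, and by monotonicity of the likelihood ratio that set is \<open>D\<^sub>i - D\<^sub>s\<close>.  Monotone
  likelihood ratios also make \<open>P\<^sub>\<theta>(K(T) < k)\<close> and \<open>P\<^sub>\<theta>(K(T) \<le> k)\<close> decreasing in \<open>\<theta>\<close>: suprema over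
  \<open>\<Theta>\<^sub>0\<close> are attained at \<open>\<theta>\<^sub>0\<close>, and the suprema over \<open>\<Theta>\<^sub>1\<close> of the two terms of the mean add up.\<close>

section \<open>Cuts and the essential statistic\<close>

text \<open>The midpoints and offsets of 1 in \<open>essential\<close> matter only through the
  strict order they produce: tests, levels and votes see \<open>K\<close> through comparisons alone.
  The obstacle is that the levels are claimed at every \<omega>, with no null event to spare, so
  \<open>Di\<close> and \<open>Ds\<close> must fit \<open>K\<close> exactly. \<open>Di - Ds\<close>
  has to lie on one level of \<open>K\<close>, strictly below the rest, because every lower test
  must reject there; \<open>Ds\<close> has to be closed under increasing \<open>K\<close>. The
  average of two least levels arises because certain rejection at \<omega> pays for the whole event
  K(T) = K(T(\<omega>)), while rejection with positive probability pays for an arbitrarily small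
  fraction of it; in the mean that event counts half.\<close>

lemma cut_fun_eq: "cut_fun c x = of_bool (Cut (ereal x) True \<le> c)"
  by (auto simp: cut_fun_def less_eq_cut_def)

text \<open>\<open>Cut x True\<close> is the immediate successor of \<open>Cut x False\<close>. This
  is what allows closed conditions on cuts to be exchanged for open ones.\<close>

lemma not_Cut_True_le_iff: "\<not> Cut (ereal x) True \<le> c \<longleftrightarrow> c \<le> Cut (ereal x) False"
  by (auto simp: less_eq_cut_def)

text \<open>A half-line is determined by its supremum and by whether the supremum is attained. The
  empty set and the whole line are represented by the two ends of \<open>F\<close>, not by the
  formal bottom and top of the type.\<close>

lemma down_closed_eq_cut_fun:
  fixes S :: "real set"
  assumes down: "\<And>x y. x \<in> S \<Longrightarrow> y \<le> x \<Longrightarrow> y \<in> S"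
  shows "\<exists>c\<in>F. cut_fun c = (\<lambda>x. of_bool (x \<in> S))"
proof -
  consider "S = {}" | "S = UNIV" | y where "S \<noteq> {}" "y \<notin> S" by blast
  then show ?thesis
  proof cases
    case 1
    then show ?thesis by (intro bexI[of _ "Cut (-\<infinity>) True"]) (auto simp: cut_fun_def F_def)
  next
    case 2
    then show ?thesis by (intro bexI[of _ "Cut \<infinity> False"]) (auto simp: cut_fun_def F_def)
  next
    case 3
    have bdd: "bdd_above S" using down[of _ y] 3(2) by (meson bdd_aboveI linear)
    have "x \<in> S" if "x < Sup S" for x
      using that 3(1) bdd down by (meson less_cSup_iff less_imp_le)
    moreover have "x \<le> Sup S" if "x \<in> S" for x using that bdd by (rule cSup_upper)
    ultimately have "cut_fun (Cut (ereal (Sup S)) (Sup S \<in> S)) x = of_bool (x \<in> S)" for x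
      by (cases x "Sup S" rule: linorder_cases) (force simp: cut_fun_def)+
    then show ?thesis
      by (intro bexI[of _ "Cut (ereal (Sup S)) (Sup S \<in> S)"]) (auto simp: F_def fun_eq_iff)
  qed
qed

lemma Cut_False_less_iff: "Cut (ereal s) False < c \<longleftrightarrow> Cut (ereal s) True \<le> c"
  by (meson not_Cut_True_le_iff not_less)

lemma less_Cut_True_iff: "c < Cut (ereal s) True \<longleftrightarrow> c \<le> Cut (ereal s) False"
  by (meson not_Cut_True_le_iff not_less)

text \<open>The separating cut lies above \<open>B s\<close> and below \<open>A t\<close>, so their
  positions are reals b \<le> a inside [s, t]. The value at s is at most b and the value at t at
  least a; if both bounds are attained, they equal s and t, which differ.\<close>

lemma essential_less:
  assumes c: "c \<in> closure_simple \<Theta>\<^sub>0 \<Theta>\<^sub>1 h" and sc: "Cut (ereal s) True \<le> c"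
    and ct: "c \<le> Cut (ereal t) False"
  shows "essential \<Theta>\<^sub>0 \<Theta>\<^sub>1 h s < essential \<Theta>\<^sub>0 \<Theta>\<^sub>1 h t"
proof -
  define A where "A x = Sup ({c \<in> closure_simple \<Theta>\<^sub>0 \<Theta>\<^sub>1 h. c \<le> Cut (ereal x) False} \<union> {Cut (-\<infinity>) False})" for x
  define B where "B x = Inf ({c \<in> closure_simple \<Theta>\<^sub>0 \<Theta>\<^sub>1 h. Cut (ereal x) True \<le> c} \<union> {Cut \<infinity> True})" for x
  have K: "essential \<Theta>\<^sub>0 \<Theta>\<^sub>1 h x = (if A x = Cut (-\<infinity>) False then -\<infinity>
         else if A x = Cut (-\<infinity>) True then pos (B x) - 1
         else if pos (B x) < \<infinity> then (pos (A x) + pos (B x)) / 2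
         else if B x = Cut \<infinity> False then pos (A x) + 1
         else \<infinity>)" for x
    by (simp add: essential_def A_def B_def Let_def)
  have A_le: "A x \<le> Cut (ereal x) False" for x
    unfolding A_def by (intro Sup_least) (auto simp: less_eq_cut_def)
  have B_ge: "Cut (ereal x) True \<le> B x" for x
    unfolding B_def by (intro Inf_greatest) (auto simp: less_eq_cut_def)
  have "B s \<le> c" unfolding B_def using c sc by (intro Inf_lower) auto
  moreover have "c \<le> A t" unfolding A_def using c ct by (intro Sup_upper) auto
  ultimately have BA: "B s \<le> A t" by (rule order_trans)
  have "Cut (ereal s) True \<le> Cut (ereal t) False" using sc ct by (rule order_trans)
  then have st: "s < t" by (auto simp: less_eq_cut_def)
  have posle: "pos x \<le> pos y" if "x \<le> y" for x y
    using that by (auto simp: less_eq_cut_def)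
  have p1: "pos (A s) \<le> ereal s" using posle[OF A_le[of s]] by simp
  have p2: "ereal s \<le> pos (B s)" using posle[OF B_ge[of s]] by simp
  have p3: "pos (B s) \<le> pos (A t)" using posle[OF BA] by simp
  have p4: "pos (A t) \<le> ereal t" using posle[OF A_le[of t]] by simp
  have p5: "ereal t \<le> pos (B t)" using posle[OF B_ge[of t]] by simp
  obtain b where b: "pos (B s) = ereal b"
    using p2 p3 p4 by (metis ereal_infty_less_eq2(1,2) ereal_cases order_trans PInfty_neq_ereal(1) MInfty_neq_ereal(1))
  obtain a where a: "pos (A t) = ereal a"
    using b p3 p4 by (metis ereal_infty_less_eq2(1,2) ereal_cases PInfty_neq_ereal(1) MInfty_neq_ereal(1))
  have ab: "s \<le> b" "b \<le> a" "a \<le> t" using p2 p3 p4 a b by auto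
  \<comment> \<open>A midpoint of \<open>A t\<close> and \<open>B t\<close> can equal a only if both
    have the same position, and t lies between these positions.\<close>
  have Kt: "ereal a < essential \<Theta>\<^sub>0 \<Theta>\<^sub>1 h t \<or> ereal a = essential \<Theta>\<^sub>0 \<Theta>\<^sub>1 h t \<and> a = t"
    using a ab p5 unfolding K by (cases "pos (B t)"; cases "A t"; auto)
  have Ks: "essential \<Theta>\<^sub>0 \<Theta>\<^sub>1 h s < ereal b \<or> essential \<Theta>\<^sub>0 \<Theta>\<^sub>1 h s = ereal b \<and> b = s"
    using b ab p1 unfolding K by (cases "A s"; cases "pos (A s)"; auto simp: one_ereal_def)
  show ?thesis
    using Kt
  proof
    assume "ereal a < essential \<Theta>\<^sub>0 \<Theta>\<^sub>1 h t"
    moreover have "essential \<Theta>\<^sub>0 \<Theta>\<^sub>1 h s \<le> ereal b" "ereal b \<le> ereal a" using Ks ab by auto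
    ultimately show ?thesis by order
  next
    assume *: "ereal a = essential \<Theta>\<^sub>0 \<Theta>\<^sub>1 h t \<and> a = t"
    have "essential \<Theta>\<^sub>0 \<Theta>\<^sub>1 h s < ereal a"
      using Ks
    proof
      assume "essential \<Theta>\<^sub>0 \<Theta>\<^sub>1 h s < ereal b"
      moreover have "ereal b \<le> ereal a" using ab by simp
      ultimately show ?thesis by order
    qed (use * st in auto)
    with conjunct1[OF *] show ?thesis by metis
  qed
qed

text \<open>\<open>essential\<close> depends on its argument only through the sets of closure points
  on either side of it, and these change only when a closure point is crossed.\<close>

lemma essential_eq:
  assumes st: "s \<le> t"
    and no_cut: "\<And>c. \<not> (c \<in> closure_simple \<Theta>\<^sub>0 \<Theta>\<^sub>1 h \<and> Cut (ereal s) True \<le> c \<and> c \<le> Cut (ereal t) False)"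
  shows "essential \<Theta>\<^sub>0 \<Theta>\<^sub>1 h s = essential \<Theta>\<^sub>0 \<Theta>\<^sub>1 h t"
proof -
  have mono: "Cut (ereal s) u \<le> Cut (ereal t) u" for u
    using st by (auto simp: less_eq_cut_def)
  have "{c \<in> closure_simple \<Theta>\<^sub>0 \<Theta>\<^sub>1 h. c \<le> Cut (ereal s) False}
      = {c \<in> closure_simple \<Theta>\<^sub>0 \<Theta>\<^sub>1 h. c \<le> Cut (ereal t) False}"
    using no_cut mono[of False] order_trans not_Cut_True_le_iff by blast
  moreover have "{c \<in> closure_simple \<Theta>\<^sub>0 \<Theta>\<^sub>1 h. Cut (ereal s) True \<le> c}
      = {c \<in> closure_simple \<Theta>\<^sub>0 \<Theta>\<^sub>1 h. Cut (ereal t) True \<le> c}"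
    using no_cut mono[of True] order_trans not_Cut_True_le_iff by blast
  ultimately show ?thesis by (simp add: essential_def)
qed

lemma mono_essential: "mono (essential \<Theta>\<^sub>0 \<Theta>\<^sub>1 h)"
proof (rule monoI)
  fix s t :: real assume "s \<le> t"
  show "essential \<Theta>\<^sub>0 \<Theta>\<^sub>1 h s \<le> essential \<Theta>\<^sub>0 \<Theta>\<^sub>1 h t"
  proof (cases "\<exists>c. c \<in> closure_simple \<Theta>\<^sub>0 \<Theta>\<^sub>1 h \<and> Cut (ereal s) True \<le> c \<and> c \<le> Cut (ereal t) False")
    case True
    then show ?thesis using essential_less by (blast intro: less_imp_le)
  next
    case False
    then show ?thesis using essential_eq[OF \<open>s \<le> t\<close>] by (intro eq_refl) blast
  qed
qed

text \<open>With \<beta> in {0, 1} the simple test is the indicator of a sublevel set, strict or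
  not, of a monotone function, hence of a lower half-line.\<close>

lemma simple_test_cut:
  assumes "mono g" "\<beta> \<in> {0, 1}"
  shows "\<exists>c\<in>F. cut_fun c = simple_test g k \<beta>"
proof -
  have *: "simple_test g k \<beta> = (\<lambda>x. of_bool (x \<in> {x. g x < k \<or> g x = k \<and> \<beta> = 1}))"
    using assms(2) by (auto simp: simple_test_def fun_eq_iff)
  have "g y < k \<or> g y = k \<and> \<beta> = 1" if "g x < k \<or> g x = k \<and> \<beta> = 1" "y \<le> x" for x y
    using that monoD[OF assms(1) that(2)] by auto
  then show ?thesis unfolding * by (intro down_closed_eq_cut_fun) auto
qed

lemma essential_less_if_ratio_less:
  assumes "\<theta>\<^sub>0 \<in> \<Theta>\<^sub>0" "\<theta>\<^sub>1 \<in> \<Theta>\<^sub>1" and mono: "mono (h \<theta>\<^sub>0 \<theta>\<^sub>1)" and less: "h \<theta>\<^sub>0 \<theta>\<^sub>1 s < h \<theta>\<^sub>0 \<theta>\<^sub>1 t"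
  shows "essential \<Theta>\<^sub>0 \<Theta>\<^sub>1 h s < essential \<Theta>\<^sub>0 \<Theta>\<^sub>1 h t"
proof -
  \<comment> \<open>The non-strict sublevel set at the value attained in s contains s but not
    t.\<close>
  let ?k = "h \<theta>\<^sub>0 \<theta>\<^sub>1 s"
  obtain c where c: "c \<in> F" "cut_fun c = simple_test (h \<theta>\<^sub>0 \<theta>\<^sub>1) ?k 1"
    using simple_test_cut[OF mono] by blast
  \<comment> \<open>The pair \<open>(?k, 1)\<close> is admissible for \<open>?k = 0\<close> and for
    positive finite \<open>?k\<close>; the value \<infinity> would not be.\<close>
  have "?k < \<infinity>" using less by (rule order_less_le_trans) simp
  then have "(?k, 1) \<in> {(0, 1)} \<union> ({0<..<\<infinity>} \<times> {0, 1}) \<union> {(\<infinity>, 0::real)}"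
    by (auto simp: zero_less_iff_neq_zero)
  then have "cut_fun c \<in> simple_tests \<Theta>\<^sub>0 \<Theta>\<^sub>1 h"
    unfolding simple_tests_def c(2) using assms(1,2) by blast
  then have "c \<in> closure_simple \<Theta>\<^sub>0 \<Theta>\<^sub>1 h"
    unfolding closure_simple_def using c(1) closure_subset[of "{c \<in> F. cut_fun c \<in> simple_tests \<Theta>\<^sub>0 \<Theta>\<^sub>1 h}"] by blast
  moreover have "cut_fun c s = 1" "cut_fun c t = 0"
    using less unfolding c(2) by (auto simp: simple_test_def)
  then have "Cut (ereal s) True \<le> c" "c \<le> Cut (ereal t) False"
    by (auto simp: cut_fun_eq not_Cut_True_le_iff[symmetric])
  ultimately show ?thesis by (rule essential_less)
qed

text \<open>In the order of cuts the interval from \<open>Cut s True\<close> to \<open>Cut t False\<close> is open,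
  so a limit of simple tests that separates \<open>s\<close> from \<open>t\<close> yields a simple test that does.\<close>

lemma essential_eq_if_ratios_eq:
  assumes st: "s \<le> t"
    and eq: "\<And>\<theta>\<^sub>0 \<theta>\<^sub>1. \<theta>\<^sub>0 \<in> \<Theta>\<^sub>0 \<Longrightarrow> \<theta>\<^sub>1 \<in> \<Theta>\<^sub>1 \<Longrightarrow> h \<theta>\<^sub>0 \<theta>\<^sub>1 s = h \<theta>\<^sub>0 \<theta>\<^sub>1 t"
  shows "essential \<Theta>\<^sub>0 \<Theta>\<^sub>1 h s = essential \<Theta>\<^sub>0 \<Theta>\<^sub>1 h t"
proof (rule essential_eq[OF st], rule notI)
  let ?S = "{c \<in> F. cut_fun c \<in> simple_tests \<Theta>\<^sub>0 \<Theta>\<^sub>1 h}"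
  let ?I = "{Cut (ereal s) False<..<Cut (ereal t) True}"
  fix c assume c: "c \<in> closure_simple \<Theta>\<^sub>0 \<Theta>\<^sub>1 h \<and> Cut (ereal s) True \<le> c \<and> c \<le> Cut (ereal t) False"
  then have "c \<in> ?I \<inter> closure ?S"
    by (auto simp: closure_simple_def Cut_False_less_iff less_Cut_True_iff)
  then have "?I \<inter> ?S \<noteq> {}"
    using open_Int_closure_eq_empty[of ?I ?S] by auto
  then obtain d where d: "cut_fun d \<in> simple_tests \<Theta>\<^sub>0 \<Theta>\<^sub>1 h"
    "Cut (ereal s) True \<le> d" "d \<le> Cut (ereal t) False"
    by (auto simp: Cut_False_less_iff less_Cut_True_iff)
  from d(1) obtain \<theta>\<^sub>0 \<theta>\<^sub>1 k \<beta> where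
    *: "\<theta>\<^sub>0 \<in> \<Theta>\<^sub>0" "\<theta>\<^sub>1 \<in> \<Theta>\<^sub>1" "cut_fun d = simple_test (h \<theta>\<^sub>0 \<theta>\<^sub>1) k \<beta>"
    by (auto simp: simple_tests_def)
  have "cut_fun d s = cut_fun d t"
    unfolding *(3) simple_test_def eq[OF *(1,2)] ..
  then show False
    using d(2,3) by (simp add: cut_fun_eq not_Cut_True_le_iff[symmetric])
qed

section \<open>Tests in models with monotone likelihood ratio\<close>

lemma prob_space_law: "stat_model M \<Theta> p \<Longrightarrow> \<theta> \<in> \<Theta> \<Longrightarrow> prob_space (law M p \<theta>)"
  by (auto simp: stat_model_def law_def)

lemma space_law [simp]: "space (law M p \<theta>) = space M"
  and sets_law [simp, measurable_cong]: "sets (law M p \<theta>) = sets M"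
  by (auto simp: law_def)

lemma integral_law:
  assumes "stat_model M \<Theta> p" "\<theta> \<in> \<Theta>" "f \<in> borel_measurable M"
  shows "integral\<^sup>L (law M p \<theta>) f = (\<integral>\<omega>. p \<theta> \<omega> * f \<omega> \<partial>M)"
  using assms unfolding law_def stat_model_def by (intro integral_real_density) auto

lemma integrable_law:
  assumes "stat_model M \<Theta> p" "\<theta> \<in> \<Theta>" "f \<in> borel_measurable M"
    and "\<And>\<omega>. \<omega> \<in> space M \<Longrightarrow> \<bar>f \<omega>\<bar> \<le> (B::real)"
  shows "integrable (law M p \<theta>) f"
proof -
  interpret prob_space "law M p \<theta>" using assms(1,2) by (rule prob_space_law)
  show ?thesis using assms(3,4) by (intro integrable_const_bound[where B = B]) auto
qed

lemma integrable_density_times: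
  assumes "stat_model M \<Theta> p" "\<theta> \<in> \<Theta>" "f \<in> borel_measurable M"
    and "\<And>\<omega>. \<omega> \<in> space M \<Longrightarrow> \<bar>f \<omega>\<bar> \<le> (B::real)"
  shows "integrable M (\<lambda>\<omega>. p \<theta> \<omega> * f \<omega>)"
proof -
  have "integrable (law M p \<theta>) f" by (rule integrable_law[OF assms(1-3)]) (rule assms(4))
  then show ?thesis
    using assms(1-3) unfolding law_def stat_model_def
    by (subst (asm) integrable_real_density) auto
qed

lemma integrable_law_test: "stat_model M \<Theta> p \<Longrightarrow> \<theta> \<in> \<Theta> \<Longrightarrow> is_test M \<phi> \<Longrightarrow> integrable (law M p \<theta>) \<phi>"
  by (rule integrable_law[where B = 1]) (auto simp: is_test_def)

lemma integral_law_test_bounds: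
  assumes "stat_model M \<Theta> p" "\<theta> \<in> \<Theta>" "is_test M \<phi>"
  shows "0 \<le> integral\<^sup>L (law M p \<theta>) \<phi>" "integral\<^sup>L (law M p \<theta>) \<phi> \<le> 1"
proof -
  interpret prob_space "law M p \<theta>" using assms(1,2) by (rule prob_space_law)
  show "0 \<le> integral\<^sup>L (law M p \<theta>) \<phi>"
    using assms(3) by (intro integral_nonneg_AE) (auto simp: is_test_def)
  show "integral\<^sup>L (law M p \<theta>) \<phi> \<le> 1"
    using assms(3) integrable_law_test[OF assms] by (intro integral_le_const) (auto simp: is_test_def)
qed

lemma integral_law_mono:
  assumes "stat_model M \<Theta> p" "\<theta> \<in> \<Theta>" "is_test M \<phi>" "is_test M \<psi>"
    and "\<And>\<omega>. \<omega> \<in> space M \<Longrightarrow> \<phi> \<omega> \<le> \<psi> \<omega>"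
  shows "integral\<^sup>L (law M p \<theta>) \<phi> \<le> integral\<^sup>L (law M p \<theta>) \<psi>"
  using assms(5) by (intro integral_mono integrable_law_test[OF assms(1,2)] assms(3,4)) auto

lemma integral_law_le_level:
  assumes "stat_model M \<Theta> p" "H \<subseteq> \<Theta>" "is_test M \<phi>" "\<theta> \<in> H"
  shows "integral\<^sup>L (law M p \<theta>) \<phi> \<le> level M p H \<phi>"
  unfolding level_def using assms integral_law_test_bounds(2)[OF assms(1) _ assms(3)]
  by (intro cSUP_upper bdd_aboveI2[where M = 1]) auto

lemma level_mono:
  assumes "stat_model M \<Theta> p" "H \<subseteq> \<Theta>" "H \<noteq> {}" "is_test M \<phi>" "is_test M \<psi>"
    and "\<And>\<omega>. \<omega> \<in> space M \<Longrightarrow> \<phi> \<omega> \<le> \<psi> \<omega>"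
  shows "level M p H \<phi> \<le> level M p H \<psi>"
  unfolding level_def[of _ _ _ \<phi>]
proof (rule cSUP_least[OF assms(3)])
  fix \<theta> assume "\<theta> \<in> H"
  then have "integral\<^sup>L (law M p \<theta>) \<phi> \<le> integral\<^sup>L (law M p \<theta>) \<psi>"
    using assms by (intro integral_law_mono[OF assms(1)]) auto
  also have "\<dots> \<le> level M p H \<psi>"
    using assms \<open>\<theta> \<in> H\<close> by (intro integral_law_le_level[OF assms(1)])
  finally show "integral\<^sup>L (law M p \<theta>) \<phi> \<le> level M p H \<psi>" .
qed

section \<open>Comparison of expectations under two parameters\<close>

lemma integral_law_compare:
  assumes model: "stat_model M \<Theta> p" and \<theta>: "\<theta> \<in> \<Theta>" "\<theta>' \<in> \<Theta>"
    and f: "f \<in> borel_measurable M" "\<And>\<omega>. \<omega> \<in> space M \<Longrightarrow> \<bar>f \<omega>\<bar> \<le> B"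
    and nonneg: "AE \<omega> in M. 0 \<le> f \<omega> * (a * p \<theta> \<omega> - b * p \<theta>' \<omega>)"
  shows "b * integral\<^sup>L (law M p \<theta>') f \<le> a * integral\<^sup>L (law M p \<theta>) f"
proof -
  note int = integrable_density_times[OF model _ f]
  \<comment> \<open>Both expectations are written as integrals against \<open>M\<close>, so the
    claim is the sign of one integral.\<close>
  have "0 \<le> (\<integral>\<omega>. a * (p \<theta> \<omega> * f \<omega>) - b * (p \<theta>' \<omega> * f \<omega>) \<partial>M)"
    using nonneg by (intro integral_nonneg_AE) (auto elim!: eventually_mono simp: algebra_simps)
  also have "\<dots> = a * integral\<^sup>L (law M p \<theta>) f - b * integral\<^sup>L (law M p \<theta>') f"
    using \<theta> int by (simp add: integral_law[OF model _ f(1)])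
  finally show ?thesis by simp
qed

text \<open>Two zeros are excluded because in \<open>ennreal\<close> the quotient 0 / 0 is 0, not
  \<infinity>.\<close>

lemma ennreal_ratio:
  assumes "0 \<le> a" "0 \<le> b" "a \<noteq> 0 \<or> b \<noteq> 0"
  shows "ennreal a / ennreal b = (if b = 0 then \<infinity> else ennreal (a / b))"
  using assms by (auto simp: divide_ennreal ennreal_divide_zero)

text \<open>The classical sign argument for \<open>\<phi> - \<psi>\<close> times a weighted
  difference of densities, with a critical value in [0, \<infinity>]. A finite r > 0 uses the
  weights r and 1; at \<infinity> and at 0 the null density gets weight 0. The clause
  \<open>p \<theta>\<^sub>0 \<omega> = 0\<close> serves k = 0, where no ratio is below k.\<close>

lemma neyman_pearson:
  fixes k :: ennreal
  assumes model: "stat_model M \<Theta> p" and \<theta>: "\<theta>\<^sub>0 \<in> \<Theta>" "\<theta>\<^sub>1 \<in> \<Theta>"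
    and \<phi>: "is_test M \<phi>" and \<psi>: "is_test M \<psi>"
    and one: "\<And>\<omega>. \<omega> \<in> space M \<Longrightarrow> p \<theta>\<^sub>0 \<omega> \<noteq> 0 \<or> p \<theta>\<^sub>1 \<omega> \<noteq> 0 \<Longrightarrow>
      ennreal (p \<theta>\<^sub>0 \<omega>) / ennreal (p \<theta>\<^sub>1 \<omega>) < k \<or> p \<theta>\<^sub>0 \<omega> = 0 \<Longrightarrow> \<phi> \<omega> = 1"
    and zero: "\<And>\<omega>. \<omega> \<in> space M \<Longrightarrow> p \<theta>\<^sub>0 \<omega> \<noteq> 0 \<or> p \<theta>\<^sub>1 \<omega> \<noteq> 0 \<Longrightarrow>
      k < ennreal (p \<theta>\<^sub>0 \<omega>) / ennreal (p \<theta>\<^sub>1 \<omega>) \<Longrightarrow> \<phi> \<omega> = 0"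
    and le: "integral\<^sup>L (law M p \<theta>\<^sub>0) \<psi> \<le> integral\<^sup>L (law M p \<theta>\<^sub>0) \<phi>"
  shows "integral\<^sup>L (law M p \<theta>\<^sub>1) \<psi> \<le> integral\<^sup>L (law M p \<theta>\<^sub>1) \<phi>"
proof -
  have p: "0 \<le> p \<theta>\<^sub>0 \<omega>" "0 \<le> p \<theta>\<^sub>1 \<omega>" if "\<omega> \<in> space M" for \<omega>
    using model \<theta> that by (auto simp: stat_model_def)
  have t: "0 \<le> \<phi> \<omega>" "\<phi> \<omega> \<le> 1" "0 \<le> \<psi> \<omega>" "\<psi> \<omega> \<le> 1" if "\<omega> \<in> space M" for \<omega>
    using \<phi> \<psi> that by (auto simp: is_test_def)
  have [measurable]: "\<phi> \<in> borel_measurable M" "\<psi> \<in> borel_measurable M"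
    using \<phi> \<psi> by (auto simp: is_test_def)
  let ?f = "\<lambda>\<omega>. \<phi> \<omega> - \<psi> \<omega>"
  have cmp: "b * integral\<^sup>L (law M p \<theta>\<^sub>0) ?f \<le> a * integral\<^sup>L (law M p \<theta>\<^sub>1) ?f"
    if "AE \<omega> in M. 0 \<le> ?f \<omega> * (a * p \<theta>\<^sub>1 \<omega> - b * p \<theta>\<^sub>0 \<omega>)" for a b
  proof (intro integral_law_compare[OF model \<theta>(2,1), where B = 1] that)
    show "\<bar>?f \<omega>\<bar> \<le> 1" if "\<omega> \<in> space M" for \<omega> using t[OF that] by (simp add: abs_le_iff)
  qed simp
  have diff: "integral\<^sup>L (law M p \<theta>) ?f = integral\<^sup>L (law M p \<theta>) \<phi> - integral\<^sup>L (law M p \<theta>) \<psi>"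
    if "\<theta> \<in> \<Theta>" for \<theta>
    using integrable_law_test[OF model that] \<phi> \<psi> by (intro Bochner_Integration.integral_diff) auto
  consider "k = \<infinity>" | r where "k = ennreal r" "0 < r" | "k = 0"
    by (cases k) (auto simp: order.order_iff_strict)
  then show ?thesis
  proof cases
    case 1
    have "0 \<le> ?f \<omega> * (1 * p \<theta>\<^sub>1 \<omega> - 0 * p \<theta>\<^sub>0 \<omega>)" if "\<omega> \<in> space M" for \<omega>
    proof (cases "p \<theta>\<^sub>1 \<omega> = 0")
      case False
      then have "\<phi> \<omega> = 1" using one[OF that] p[OF that] 1 by (auto simp: ennreal_ratio)
      then show ?thesis using p[OF that] t[OF that] by simp
    qed simp
    from cmp[OF AE_I2[OF this]] show ?thesis using diff \<theta> by simp
  next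
    case 2
    have "0 \<le> ?f \<omega> * (r * p \<theta>\<^sub>1 \<omega> - 1 * p \<theta>\<^sub>0 \<omega>)" if \<omega>: "\<omega> \<in> space M" for \<omega>
    proof (cases "p \<theta>\<^sub>0 \<omega>" "r * p \<theta>\<^sub>1 \<omega>" rule: linorder_cases)
      case less
      then have "0 < p \<theta>\<^sub>1 \<omega>" using 2 p[OF \<omega>] by (auto simp: order.order_iff_strict)
      then have "\<phi> \<omega> = 1"
        using one[OF \<omega>] p[OF \<omega>] 2 less by (auto simp: ennreal_ratio ennreal_less_iff divide_simps mult.commute)
      then show ?thesis using less t[OF \<omega>] by simp
    next
      case greater
      then have "0 < p \<theta>\<^sub>0 \<omega>" using 2 p[OF \<omega>] by (smt (verit) mult_nonneg_nonneg)
      then have "\<phi> \<omega> = 0"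
        using zero[OF \<omega>] p[OF \<omega>] 2 greater by (auto simp: ennreal_ratio ennreal_less_iff divide_simps mult.commute)
      then show ?thesis using greater t[OF \<omega>] by (intro mult_nonpos_nonpos) auto
    qed simp
    from cmp[OF AE_I2[OF this]] have "0 \<le> r * integral\<^sup>L (law M p \<theta>\<^sub>1) ?f"
      using le diff \<theta> by simp
    then show ?thesis using 2 diff \<theta> by (simp add: zero_le_mult_iff)
  next
    case 3
    \<comment> \<open>For k = 0 the test has level 0. Then \<open>\<psi>\<close> vanishes almost
      everywhere that \<open>p \<theta>\<^sub>0\<close> is positive, and where
      \<open>p \<theta>\<^sub>0\<close> is 0 and \<open>p \<theta>\<^sub>1\<close> is not,
      \<open>\<phi>\<close> already equals 1.\<close>
    have *: "p \<theta>\<^sub>0 \<omega> * \<phi> \<omega> = 0" if "\<omega> \<in> space M" for \<omega>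
      using zero[OF that] p[OF that] 3
      by (cases "p \<theta>\<^sub>0 \<omega> = 0") (auto simp: ennreal_ratio ennreal_zero_less_divide)
    have "(\<integral>\<omega>. p \<theta>\<^sub>0 \<omega> * \<psi> \<omega> \<partial>M) \<le> (\<integral>\<omega>. p \<theta>\<^sub>0 \<omega> * \<phi> \<omega> \<partial>M)"
      using le by (simp add: integral_law[OF model \<theta>(1)])
    also have "\<dots> = (\<integral>\<omega>. 0 \<partial>M)" using * by (intro Bochner_Integration.integral_cong) auto
    finally have "(\<integral>\<omega>. p \<theta>\<^sub>0 \<omega> * \<psi> \<omega> \<partial>M) \<le> 0" by simp
    moreover have nn: "AE \<omega> in M. 0 \<le> p \<theta>\<^sub>0 \<omega> * \<psi> \<omega>" using p t by (intro AE_I2) auto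
    ultimately have "(\<integral>\<omega>. p \<theta>\<^sub>0 \<omega> * \<psi> \<omega> \<partial>M) = 0"
      using integral_nonneg_AE[OF nn] by linarith
    then have "AE \<omega> in M. p \<theta>\<^sub>0 \<omega> * \<psi> \<omega> = 0"
      using integral_nonneg_eq_0_iff_AE[OF integrable_density_times[OF model \<theta>(1), where B = 1] nn] t
      by auto
    then have "AE \<omega> in M. 0 \<le> ?f \<omega> * (1 * p \<theta>\<^sub>1 \<omega> - 0 * p \<theta>\<^sub>0 \<omega>)"
    proof (rule AE_mp, intro AE_I2 impI)
      fix \<omega> assume \<omega>: "\<omega> \<in> space M" and "p \<theta>\<^sub>0 \<omega> * \<psi> \<omega> = 0"
      then have "\<psi> \<omega> = 0 \<or> p \<theta>\<^sub>1 \<omega> = 0 \<or> \<phi> \<omega> = 1" using one[OF \<omega>] by auto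
      then show "0 \<le> ?f \<omega> * (1 * p \<theta>\<^sub>1 \<omega> - 0 * p \<theta>\<^sub>0 \<omega>)" using p[OF \<omega>] t[OF \<omega>] by auto
    qed
    from cmp[OF this] show ?thesis using diff \<theta> by simp
  qed
qed

lemma is_test_antimono:
  fixes \<Phi> :: "real \<Rightarrow> real"
  assumes "T \<in> borel_measurable M" "antimono \<Phi>" "\<And>x. 0 \<le> \<Phi> x \<and> \<Phi> x \<le> 1"
  shows "is_test M (\<lambda>\<omega>. \<Phi> (T \<omega>))"
proof -
  have "mono (\<lambda>x. - \<Phi> x)" using assms(2) by (auto simp: monotone_def)
  then have "(\<lambda>x. - (- \<Phi> x)) \<in> borel_measurable borel"
    by (intro borel_measurable_uminus borel_measurable_mono)
  then have "\<Phi> \<in> borel_measurable borel" by simp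
  then show ?thesis
    using assms(1,3) unfolding is_test_def by auto
qed

text \<open>With \<open>c\<close> between the values of \<open>\<Phi>\<close> where the ratio is below 1 and those where it is above 1,
  \<open>(\<Phi> (T \<omega>) - c) * (p \<theta>' \<omega> - p \<theta>'' \<omega>)\<close> is nonnegative.\<close>

lemma integral_law_antimono:
  fixes \<Phi> :: "real \<Rightarrow> real"
  assumes model: "stat_model M \<Theta> p" and mlr: "monotone_likelihood_ratio M \<Theta> p T"
    and \<theta>: "\<theta>' \<in> \<Theta>" "\<theta>'' \<in> \<Theta>" "\<theta>' \<le> \<theta>''"
    and \<Phi>: "antimono \<Phi>" "\<And>x. 0 \<le> \<Phi> x \<and> \<Phi> x \<le> 1"
  shows "integral\<^sup>L (law M p \<theta>'') (\<lambda>\<omega>. \<Phi> (T \<omega>)) \<le> integral\<^sup>L (law M p \<theta>') (\<lambda>\<omega>. \<Phi> (T \<omega>))"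
proof (cases "\<theta>' = \<theta>''")
  case False
  then obtain g where g: "mono g"
    "\<And>\<omega>. \<omega> \<in> space M \<Longrightarrow> p \<theta>'' \<omega> \<noteq> 0 \<or> p \<theta>' \<omega> \<noteq> 0 \<Longrightarrow> ennreal (p \<theta>'' \<omega>) / ennreal (p \<theta>' \<omega>) = g (T \<omega>)"
    using mlr \<theta> unfolding monotone_likelihood_ratio_def monotone_ratio_def by (meson order.not_eq_order_implies_strict)
  have test: "is_test M (\<lambda>\<omega>. \<Phi> (T \<omega>))"
    using mlr \<Phi> by (intro is_test_antimono) (auto simp: monotone_likelihood_ratio_def)
  then have [measurable]: "(\<lambda>\<omega>. \<Phi> (T \<omega>)) \<in> borel_measurable M" by (simp add: is_test_def)
  have p: "0 \<le> p \<theta>' \<omega>" "0 \<le> p \<theta>'' \<omega>" if "\<omega> \<in> space M" for \<omega>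
    using model \<theta> that by (auto simp: stat_model_def)
  \<comment> \<open>Inserting 0, a lower bound of \<open>\<Phi>\<close>, keeps the supremum
    meaningful when no ratio exceeds 1.\<close>
  define c where "c = Sup (insert 0 (\<Phi> ` {x. 1 < g x}))"
  have bdd: "bdd_above (insert 0 (\<Phi> ` {x. 1 < g x}))" using \<Phi>(2) by (intro bdd_aboveI[where M = 1]) auto
  have above: "\<Phi> x \<le> c" if "1 < g x" for x
    unfolding c_def using that bdd by (intro cSup_upper) auto
  have below: "c \<le> \<Phi> x" if "g x < 1" for x
    unfolding c_def
  proof (rule cSup_least)
    fix y assume "y \<in> insert 0 (\<Phi> ` {x. 1 < g x})"
    then show "y \<le> \<Phi> x"
    proof
      assume "y \<in> \<Phi> ` {x. 1 < g x}"
      then obtain z where z: "y = \<Phi> z" "1 < g z" by auto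
      then have "\<not> z \<le> x" using monoD[OF g(1), of z x] that by (metis less_asym order_le_less_trans)
      then show ?thesis using z antimonoD[OF \<Phi>(1), of x z] by simp
    qed (use \<Phi>(2) in simp)
  qed simp
  have c: "0 \<le> c" "c \<le> 1"
    unfolding c_def using bdd \<Phi>(2) by (auto intro!: cSup_upper cSup_least)
  have "0 \<le> (\<Phi> (T \<omega>) - c) * (1 * p \<theta>' \<omega> - 1 * p \<theta>'' \<omega>)" if \<omega>: "\<omega> \<in> space M" for \<omega>
  proof (cases "p \<theta>' \<omega>" "p \<theta>'' \<omega>" rule: linorder_cases)
    case less
    then have "1 < g (T \<omega>)"
      using p[OF \<omega>] by (subst g(2)[OF \<omega>, symmetric]) (auto simp: ennreal_ratio ennreal_1[symmetric] ennreal_less_iff simp del: ennreal_1)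
    then show ?thesis using above less by (simp add: mult_nonpos_nonpos)
  next
    case greater
    then have "g (T \<omega>) < 1"
      using p[OF \<omega>] by (subst g(2)[OF \<omega>, symmetric]) (auto simp: ennreal_ratio ennreal_1[symmetric] ennreal_less_iff simp del: ennreal_1)
    then show ?thesis using below greater by simp
  qed simp
  then have "1 * integral\<^sup>L (law M p \<theta>'') (\<lambda>\<omega>. \<Phi> (T \<omega>) - c) \<le> 1 * integral\<^sup>L (law M p \<theta>') (\<lambda>\<omega>. \<Phi> (T \<omega>) - c)"
  proof (intro integral_law_compare[OF model \<theta>(1,2), where B = 1] AE_I2)
    show "\<bar>\<Phi> (T \<omega>) - c\<bar> \<le> 1" for \<omega> using \<Phi>(2)[of "T \<omega>"] c by (simp add: abs_le_iff)
  qed auto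
  moreover have "integral\<^sup>L (law M p \<theta>) (\<lambda>\<omega>. \<Phi> (T \<omega>) - c) = integral\<^sup>L (law M p \<theta>) (\<lambda>\<omega>. \<Phi> (T \<omega>)) - c"
    if "\<theta> \<in> \<Theta>" for \<theta>
  proof -
    interpret prob_space "law M p \<theta>" using model that by (rule prob_space_law)
    show ?thesis using integrable_law_test[OF model that test] prob_space
      by (subst Bochner_Integration.integral_diff) simp_all
  qed
  ultimately show ?thesis using \<theta> by simp
qed simp

section \<open>Step functions, infima and suprema of real families\<close>

definition step :: "'b::linorder \<Rightarrow> real \<Rightarrow> 'b \<Rightarrow> real" where
  "step c \<gamma> x = (if x < c then 1 else if x = c then \<gamma> else 0)"

lemma step_bounds: "\<gamma> \<in> {0..1} \<Longrightarrow> 0 \<le> step c \<gamma> x \<and> step c \<gamma> x \<le> 1"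
  by (auto simp: step_def)

lemma antimono_step: "\<gamma> \<in> {0..1} \<Longrightarrow> antimono (step c \<gamma>)"
  by (auto simp: step_def monotone_def)

text \<open>Turns upper tests into complements of lower tests, so that they inherit measurability,
  monotonicity and expectations from these.\<close>

lemma upper_step: "\<gamma> \<in> {0..1} \<Longrightarrow> (if x > c then 1 else if x = c then \<gamma> else 0) = 1 - step c (1 - \<gamma>) x"
  by (auto simp: step_def)

text \<open>Made for levels that are approached but need not be attained. The tolerance stays at
  most 1 because it will serve as a randomization probability.\<close>

lemma cInf_eq_approx:
  fixes X :: "real set"
  assumes lower: "\<And>x. x \<in> X \<Longrightarrow> L \<le> x"
    and approx: "\<And>e. 0 < e \<Longrightarrow> e \<le> 1 \<Longrightarrow> \<exists>x\<in>X. x \<le> L + e"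
  shows "Inf X = L"
proof (rule cInf_eq_non_empty)
  show "X \<noteq> {}" using approx[of 1] by auto
  show "y \<le> L" if y: "\<And>x. x \<in> X \<Longrightarrow> y \<le> x" for y
  proof (rule field_le_epsilon)
    fix e :: real assume "0 < e"
    then obtain x where "x \<in> X" "x \<le> L + min e 1" using approx[of "min e 1"] by auto
    then show "y \<le> L + e" using y[of x] by simp
  qed
qed (rule lower)

text \<open>For two indices the larger one dominates both terms, so independent choices of index
  gain nothing over a common one.\<close>

lemma SUP_add_directed:
  fixes f g :: "'b::linorder \<Rightarrow> real"
  assumes "I \<noteq> {}" and bdd: "bdd_above (f ` I)" "bdd_above (g ` I)"
    and mono: "mono_on I f" "mono_on I g"
  shows "(SUP x\<in>I. f x + g x) = (SUP x\<in>I. f x) + (SUP x\<in>I. g x)"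
proof (rule antisym)
  show "(SUP x\<in>I. f x + g x) \<le> (SUP x\<in>I. f x) + (SUP x\<in>I. g x)"
    using assms(1) bdd by (intro cSUP_least add_mono cSUP_upper)
  have bdd': "bdd_above ((\<lambda>x. f x + g x) ` I)"
  proof -
    obtain a b where "\<And>x. x \<in> I \<Longrightarrow> f x \<le> a" "\<And>x. x \<in> I \<Longrightarrow> g x \<le> b"
      using bdd by (auto simp: bdd_above_def)
    then show ?thesis by (intro bdd_aboveI2[where M = "a + b"] add_mono)
  qed
  have "f x + g y \<le> (SUP x\<in>I. f x + g x)" if "x \<in> I" "y \<in> I" for x y
  proof -
    have "f x + g y \<le> f (max x y) + g (max x y)"
      using that mono by (intro add_mono) (auto simp: mono_on_def max_def)
    also have "\<dots> \<le> (SUP x\<in>I. f x + g x)"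
      using that by (intro cSUP_upper2[OF bdd' _ order_refl]) (auto simp: max_def)
    finally show ?thesis .
  qed
  then have "(SUP y\<in>I. g y) \<le> (SUP x\<in>I. f x + g x) - f x" if "x \<in> I" for x
    using that assms(1) by (intro cSUP_least) (auto simp: algebra_simps)
  then have "(SUP x\<in>I. f x) \<le> (SUP x\<in>I. f x + g x) - (SUP y\<in>I. g y)"
    using assms(1) by (intro cSUP_least) (auto simp: algebra_simps)
  then show "(SUP x\<in>I. f x) + (SUP x\<in>I. g x) \<le> (SUP x\<in>I. f x + g x)" by simp
qed

text \<open>Sublevel sets are intervals. The general codomain admits \<open>K\<close>, whose values
  are extended reals.\<close>

lemma borel_measurable_mono_linorder:
  fixes f :: "real \<Rightarrow> 'b::{linorder_topology, second_countable_topology}"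
  assumes "mono f"
  shows "f \<in> borel_measurable borel"
proof (rule borel_measurableI_less)
  fix y
  have "is_interval {x. f x < y}"
    unfolding is_interval_1 using monoD[OF assms] by (auto intro: order_le_less_trans)
  then show "{x \<in> space borel. f x < y} \<in> sets borel"
    by (simp add: real_interval_borel_measurable)
qed

section \<open>One-sided hypotheses\<close>

text \<open>The parameter order is abstract; one-sidedness enters through the least element
  \<open>\<theta>\<^sub>0\<close> of the null hypothesis, where levels are attained.\<close>

locale one_sided_mlr =
  fixes M :: "'a measure" and \<Theta>\<^sub>0 \<Theta>\<^sub>1 :: "'i::linorder set" and p :: "'i \<Rightarrow> 'a \<Rightarrow> real"
    and T :: "'a \<Rightarrow> real" and h :: "'i \<Rightarrow> 'i \<Rightarrow> real \<Rightarrow> ennreal" and \<theta>\<^sub>0 :: 'i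
  assumes model: "stat_model M (\<Theta>\<^sub>0 \<union> \<Theta>\<^sub>1) p"
    and mlr: "monotone_likelihood_ratio M (\<Theta>\<^sub>0 \<union> \<Theta>\<^sub>1) p T"
    and \<theta>\<^sub>0_in: "\<theta>\<^sub>0 \<in> \<Theta>\<^sub>0" and \<theta>\<^sub>0_least: "\<And>\<theta>. \<theta> \<in> \<Theta>\<^sub>0 \<Longrightarrow> \<theta>\<^sub>0 \<le> \<theta>"
    and \<Theta>\<^sub>1_nonempty: "\<Theta>\<^sub>1 \<noteq> {}"
    and normalized: "normalized_family M p T \<Theta>\<^sub>0 \<Theta>\<^sub>1 h"
begin

abbreviation "K \<equiv> essential \<Theta>\<^sub>0 \<Theta>\<^sub>1 h"
abbreviation "Di \<equiv> D_inf M p T \<Theta>\<^sub>0"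
abbreviation "Ds \<equiv> D_sup M p T \<Theta>\<^sub>1"
abbreviation "E \<theta> \<phi> \<equiv> integral\<^sup>L (law M p \<theta>) \<phi>"
abbreviation "lower c \<gamma> \<equiv> (\<lambda>\<omega>. step c \<gamma> (K (T \<omega>)))"

lemma density_nonneg: "\<theta> \<in> \<Theta>\<^sub>0 \<union> \<Theta>\<^sub>1 \<Longrightarrow> \<omega> \<in> space M \<Longrightarrow> 0 \<le> p \<theta> \<omega>"
  using model by (auto simp: stat_model_def)

lemma T_measurable [measurable]: "T \<in> borel_measurable M"
  using mlr by (simp add: monotone_likelihood_ratio_def)

lemma K_mono: "x \<le> y \<Longrightarrow> K x \<le> K y"
  using mono_essential by (rule monoD)

lemma K_measurable [measurable]: "K \<in> borel_measurable borel"
  using mono_essential by (rule borel_measurable_mono_linorder)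

lemma
  assumes "\<theta> \<in> \<Theta>\<^sub>0" "\<theta>' \<in> \<Theta>\<^sub>1"
  shows h_mono: "mono (h \<theta> \<theta>')"
    and h_ratio: "\<And>\<omega>. \<omega> \<in> space M \<Longrightarrow> p \<theta> \<omega> \<noteq> 0 \<or> p \<theta>' \<omega> \<noteq> 0 \<Longrightarrow>
      ennreal (p \<theta> \<omega>) / ennreal (p \<theta>' \<omega>) = h \<theta> \<theta>' (T \<omega>)"
    and h_Ds: "\<And>x. x \<in> Ds \<Longrightarrow> h \<theta> \<theta>' x = \<infinity>"
    and h_Di: "\<And>x. x \<in> Di - Ds \<Longrightarrow> h \<theta> \<theta>' x = 0"
proof -
  note * = normalized[unfolded normalized_family_def Let_def, rule_format, OF assms]
  show "mono (h \<theta> \<theta>')"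
    using *[THEN conjunct1] by (simp add: monotone_ratio_def)
  show "ennreal (p \<theta> \<omega>) / ennreal (p \<theta>' \<omega>) = h \<theta> \<theta>' (T \<omega>)"
    if "\<omega> \<in> space M" "p \<theta> \<omega> \<noteq> 0 \<or> p \<theta>' \<omega> \<noteq> 0" for \<omega>
    using *[THEN conjunct1] that by (simp add: monotone_ratio_def)
  show "h \<theta> \<theta>' x = \<infinity>" if "x \<in> Ds" for x
    using *[THEN conjunct2, THEN conjunct2, THEN conjunct1] that by blast
  show "h \<theta> \<theta>' x = 0" if "x \<in> Di - Ds" for x
    using *[THEN conjunct2, THEN conjunct2, THEN conjunct2] that by blast
qed

lemma K_less_if_h_less: "\<theta> \<in> \<Theta>\<^sub>0 \<Longrightarrow> \<theta>' \<in> \<Theta>\<^sub>1 \<Longrightarrow> h \<theta> \<theta>' s < h \<theta> \<theta>' t \<Longrightarrow> K s < K t"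
  by (rule essential_less_if_ratio_less[OF _ _ h_mono])

lemma density_not_all_zero:
  assumes "\<theta> \<in> \<Theta>\<^sub>0 \<union> \<Theta>\<^sub>1"
  shows "\<exists>\<omega>\<in>space M. p \<theta> \<omega> \<noteq> 0"
proof (rule ccontr)
  interpret prob_space "law M p \<theta>" using model assms by (rule prob_space_law)
  assume "\<not> ?thesis"
  then have "(\<integral>\<omega>. p \<theta> \<omega> * 1 \<partial>M) = (\<integral>\<omega>. 0 \<partial>M)" by (intro Bochner_Integration.integral_cong) auto
  then have "E \<theta> (\<lambda>_. 1 :: real) = 0" by (subst integral_law[OF model assms]) simp_all
  then show False using prob_space by simp
qed

text \<open>Where \<open>h \<theta>\<^sub>0 \<theta>'\<close> vanishes, \<open>p \<theta>\<^sub>0\<close> vanishes; if some larger \<open>\<theta>\<close> had \<open>p \<theta> \<noteq> 0\<close> at such a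
  point, the ratio \<open>p \<theta> / p \<theta>\<^sub>0\<close> would be infinite from there on and \<open>p \<theta>\<^sub>0\<close> would vanish everywhere.\<close>

lemma h_eq_0_iff:
  assumes \<theta>': "\<theta>' \<in> \<Theta>\<^sub>1"
  shows "h \<theta>\<^sub>0 \<theta>' x = 0 \<longleftrightarrow> x \<in> Di - Ds"
proof
  assume x: "h \<theta>\<^sub>0 \<theta>' x = 0"
  let ?L = "{y. h \<theta>\<^sub>0 \<theta>' y = 0}"
  have down: "z \<in> ?L" if "y \<in> ?L" "z \<le> y" for y z
    using monoD[OF h_mono[OF \<theta>\<^sub>0_in \<theta>'] that(2)] that(1) by simp
  have zero: "p \<theta>\<^sub>0 \<omega> = 0" if \<omega>: "\<omega> \<in> space M" "T \<omega> \<in> ?L" for \<omega>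
  proof (rule ccontr)
    assume "p \<theta>\<^sub>0 \<omega> \<noteq> 0"
    then show False
      using h_ratio[OF \<theta>\<^sub>0_in \<theta>' \<omega>(1)] \<omega> density_nonneg[of \<theta>\<^sub>0 \<omega>] density_nonneg[of \<theta>' \<omega>] \<theta>\<^sub>0_in \<theta>'
      by (auto simp: ennreal_ratio ennreal_eq_0_iff divide_le_0_iff split: if_splits)
  qed
  have "vanishes_on M p T \<Theta>\<^sub>0 ?L"
    unfolding vanishes_on_def
  proof (intro ballI impI, rule ccontr)
    fix \<theta> \<omega> assume \<theta>: "\<theta> \<in> \<Theta>\<^sub>0" and \<omega>: "\<omega> \<in> space M" "T \<omega> \<in> ?L" and pos: "p \<theta> \<omega> \<noteq> 0"
    have "\<theta>\<^sub>0 < \<theta>" using \<theta>\<^sub>0_least[OF \<theta>] zero[OF \<omega>] pos by (auto simp: order.order_iff_strict)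
    then obtain g where g: "mono g"
      "\<And>\<omega>. \<omega> \<in> space M \<Longrightarrow> p \<theta> \<omega> \<noteq> 0 \<or> p \<theta>\<^sub>0 \<omega> \<noteq> 0 \<Longrightarrow> ennreal (p \<theta> \<omega>) / ennreal (p \<theta>\<^sub>0 \<omega>) = g (T \<omega>)"
      using mlr \<theta> \<theta>\<^sub>0_in unfolding monotone_likelihood_ratio_def monotone_ratio_def by blast
    have inf: "g (T \<omega>) = \<infinity>"
      using g(2)[OF \<omega>(1)] pos zero[OF \<omega>] density_nonneg[of \<theta> \<omega>] \<theta> \<omega>(1) by (auto simp: ennreal_ratio)
    obtain \<omega>' where \<omega>': "\<omega>' \<in> space M" "p \<theta>\<^sub>0 \<omega>' \<noteq> 0" using density_not_all_zero[of \<theta>\<^sub>0] \<theta>\<^sub>0_in by auto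
    then have "\<not> T \<omega>' \<le> T \<omega>" using zero[of \<omega>'] down[OF \<omega>(2)] by blast
    then have "g (T \<omega>') = \<infinity>" using monoD[OF g(1), of "T \<omega>" "T \<omega>'"] inf by (simp add: top_unique)
    then show False
      using g(2)[OF \<omega>'(1)] \<omega>' density_nonneg[of \<theta> \<omega>'] density_nonneg[of \<theta>\<^sub>0 \<omega>'] \<theta> \<theta>\<^sub>0_in
      by (auto simp: ennreal_ratio)
  qed
  then have "?L \<subseteq> Di" unfolding D_inf_def using down by blast
  then show "x \<in> Di - Ds" using x h_Ds[OF \<theta>\<^sub>0_in \<theta>', of x] by auto
qed (rule h_Di[OF \<theta>\<^sub>0_in \<theta>'])

section \<open>The half-lines \<open>Di\<close> and \<open>Ds\<close> in terms of
  \<open>K\<close>\<close>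

lemma D_up: "x \<in> Ds \<Longrightarrow> x \<le> y \<Longrightarrow> y \<in> Ds"
  unfolding D_sup_def by blast

lemma density_zero_Di: "\<theta> \<in> \<Theta>\<^sub>0 \<Longrightarrow> \<omega> \<in> space M \<Longrightarrow> T \<omega> \<in> Di \<Longrightarrow> p \<theta> \<omega> = 0"
  unfolding D_inf_def vanishes_on_def by blast

lemma density_zero_Ds: "\<theta> \<in> \<Theta>\<^sub>1 \<Longrightarrow> \<omega> \<in> space M \<Longrightarrow> T \<omega> \<in> Ds \<Longrightarrow> p \<theta> \<omega> = 0"
  unfolding D_sup_def vanishes_on_def by blast

text \<open>\<open>Di - Ds\<close> is exactly the zero set of a ratio, so that ratio is positive
  outside it and forces \<open>K\<close> up. Hence lower tests with critical value K(T(\<omega>)),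
  for \<omega> outside this region, reject on all of it.\<close>

lemma K_less_from_Di: "x \<in> Di - Ds \<Longrightarrow> y \<notin> Di - Ds \<Longrightarrow> K x < K y"
proof -
  assume "x \<in> Di - Ds" "y \<notin> Di - Ds"
  moreover obtain \<theta>' where \<theta>': "\<theta>' \<in> \<Theta>\<^sub>1" using \<Theta>\<^sub>1_nonempty by blast
  ultimately have "h \<theta>\<^sub>0 \<theta>' x < h \<theta>\<^sub>0 \<theta>' y"
    using h_eq_0_iff[OF \<theta>', of x] h_eq_0_iff[OF \<theta>', of y] by (metis zero_less_iff_neq_zero)
  then show "K x < K y" by (rule K_less_if_h_less[OF \<theta>\<^sub>0_in \<theta>'])
qed

text \<open>All ratios vanish there, so no simple test separates two of its points.\<close>

lemma K_const_Di: "x \<in> Di - Ds \<Longrightarrow> y \<in> Di - Ds \<Longrightarrow> K x = K y"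
proof (induction x y rule: linorder_wlog)
  case (le x y)
  then show ?case by (intro essential_eq_if_ratios_eq) (simp_all add: h_Di)
qed simp

text \<open>If some y < x had the same value of \<open>K\<close>, each ratio
  \<open>h \<theta>\<^sub>0 \<theta>'\<close> would be infinite from y on. Then all densities of the
  alternative vanish on that half-line, and maximality of \<open>Ds\<close> puts y into it.\<close>

lemma K_ge_Ds:
  assumes x: "x \<in> Ds" and K: "K x \<le> K y"
  shows "y \<in> Ds"
proof (cases "x \<le> y")
  case False
  then have eq: "K y = K x" using K K_mono[of y x] by simp
  have inf: "h \<theta>\<^sub>0 \<theta>' z = \<infinity>" if "\<theta>' \<in> \<Theta>\<^sub>1" "y \<le> z" for \<theta>' z
  proof -
    have "\<not> h \<theta>\<^sub>0 \<theta>' y < h \<theta>\<^sub>0 \<theta>' x" using K_less_if_h_less[OF \<theta>\<^sub>0_in that(1), of y x] eq by auto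
    then show ?thesis
      using h_Ds[OF \<theta>\<^sub>0_in that(1) x] monoD[OF h_mono[OF \<theta>\<^sub>0_in that(1)] that(2)]
      by (simp add: top_unique not_less)
  qed
  have "vanishes_on M p T \<Theta>\<^sub>1 {y..}"
    unfolding vanishes_on_def
  proof (intro ballI impI, rule ccontr)
    fix \<theta>' \<omega> assume *: "\<theta>' \<in> \<Theta>\<^sub>1" "\<omega> \<in> space M" "T \<omega> \<in> {y..}" "p \<theta>' \<omega> \<noteq> 0"
    then show False
      using h_ratio[OF \<theta>\<^sub>0_in *(1,2)] inf[OF *(1), of "T \<omega>"]
        density_nonneg[of \<theta>\<^sub>0 \<omega>] density_nonneg[of \<theta>' \<omega>] \<theta>\<^sub>0_in
      by (auto simp: ennreal_ratio)
  qed
  moreover have "\<forall>a\<in>{y..}. \<forall>b\<ge>a. b \<in> {y..}" by auto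
  ultimately have "{y..} \<subseteq> Ds" unfolding D_sup_def by blast
  then show ?thesis by auto
qed (use D_up[OF x] in blast)

section \<open>Expectations and levels of the tests built with \<open>K\<close>\<close>

lemma antimono_lower: "\<gamma> \<in> {0..1} \<Longrightarrow> antimono (\<lambda>x. step c \<gamma> (K x))"
  by (intro antimonoI antimonoD[OF antimono_step] K_mono)

lemma is_test_lower: "\<gamma> \<in> {0..1} \<Longrightarrow> is_test M (lower c \<gamma>)"
  by (rule is_test_antimono[OF T_measurable antimono_lower step_bounds])

lemma is_test_upper: "\<gamma> \<in> {0..1} \<Longrightarrow> is_test M (\<lambda>\<omega>. 1 - lower c \<gamma> \<omega>)"
  using is_test_lower[of \<gamma> c] by (auto simp: is_test_def)

lemma E_lower_antimono:
  "\<gamma> \<in> {0..1} \<Longrightarrow> \<theta> \<in> \<Theta>\<^sub>0 \<union> \<Theta>\<^sub>1 \<Longrightarrow> \<theta>' \<in> \<Theta>\<^sub>0 \<union> \<Theta>\<^sub>1 \<Longrightarrow> \<theta> \<le> \<theta>' \<Longrightarrow> E \<theta>' (lower c \<gamma>) \<le> E \<theta> (lower c \<gamma>)"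
  by (rule integral_law_antimono[OF model mlr _ _ _ antimono_lower step_bounds])

lemma E_upper:
  assumes "\<gamma> \<in> {0..1}" "\<theta> \<in> \<Theta>\<^sub>0 \<union> \<Theta>\<^sub>1"
  shows "E \<theta> (\<lambda>\<omega>. 1 - lower c \<gamma> \<omega>) = 1 - E \<theta> (lower c \<gamma>)"
proof -
  interpret prob_space "law M p \<theta>" using model assms(2) by (rule prob_space_law)
  show ?thesis using integrable_law_test[OF model assms(2) is_test_lower[OF assms(1)]] prob_space
    by (subst Bochner_Integration.integral_diff) simp_all
qed

lemma E_lower:
  assumes "\<theta> \<in> \<Theta>\<^sub>0 \<union> \<Theta>\<^sub>1"
  shows "E \<theta> (lower c \<gamma>) = measure (law M p \<theta>) {\<omega>\<in>space M. K (T \<omega>) < c}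
    + \<gamma> * measure (law M p \<theta>) {\<omega>\<in>space M. K (T \<omega>) = c}"
proof -
  interpret prob_space "law M p \<theta>" using model assms by (rule prob_space_law)
  let ?A = "{\<omega>\<in>space M. K (T \<omega>) < c}" and ?B = "{\<omega>\<in>space M. K (T \<omega>) = c}"
  have [measurable]: "?A \<in> sets (law M p \<theta>)" "?B \<in> sets (law M p \<theta>)" by simp_all
  have "E \<theta> (lower c \<gamma>) = E \<theta> (\<lambda>\<omega>. indicator ?A \<omega> + \<gamma> * indicator ?B \<omega>)"
    by (intro Bochner_Integration.integral_cong) (auto simp: step_def indicator_def)
  also have "\<dots> = measure (law M p \<theta>) ?A + \<gamma> * measure (law M p \<theta>) ?B"
    by (subst Bochner_Integration.integral_add) (auto intro!: integrable_mult_right simp: emeasure_eq_measure)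
  finally show ?thesis .
qed

text \<open>The link between votes and tests: the two terms are the expectations of the extreme
  tests whose levels are averaged in \<open>halfway_level\<close>.\<close>

lemma mean_cdf_eq:
  assumes "\<theta> \<in> \<Theta>\<^sub>0 \<union> \<Theta>\<^sub>1"
  shows "mean_cdf M p (K \<circ> T) \<theta> c = (E \<theta> (lower c 0) + E \<theta> (lower c 1)) / 2"
proof -
  interpret prob_space "law M p \<theta>" using model assms by (rule prob_space_law)
  have "{\<omega>\<in>space M. K (T \<omega>) \<le> c} = {\<omega>\<in>space M. K (T \<omega>) < c} \<union> {\<omega>\<in>space M. K (T \<omega>) = c}" by auto
  then have "measure (law M p \<theta>) {\<omega>\<in>space M. K (T \<omega>) \<le> c} =
    measure (law M p \<theta>) {\<omega>\<in>space M. K (T \<omega>) < c} + measure (law M p \<theta>) {\<omega>\<in>space M. K (T \<omega>) = c}"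
    by (simp only:) (rule finite_measure_Union, auto)
  then show ?thesis by (simp add: mean_cdf_def E_lower[OF assms])
qed

lemma level_lower:
  assumes "\<gamma> \<in> {0..1}"
  shows "level M p \<Theta>\<^sub>0 (lower c \<gamma>) = E \<theta>\<^sub>0 (lower c \<gamma>)"
  unfolding level_def using assms \<theta>\<^sub>0_in \<theta>\<^sub>0_least
  by (intro cSup_eq_maximum) (auto intro!: E_lower_antimono)

text \<open>\<open>\<Theta>\<^sub>1\<close> need not have a greatest element, so this level remains
  a supremum.\<close>

lemma level_upper:
  assumes "\<gamma> \<in> {0..1}"
  shows "level M p \<Theta>\<^sub>1 (\<lambda>\<omega>. 1 - lower c \<gamma> \<omega>) = (SUP \<theta>\<in>\<Theta>\<^sub>1. 1 - E \<theta> (lower c \<gamma>))"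
  unfolding level_def by (intro SUP_cong) (auto simp: E_upper[OF assms])

lemma lower_testsE:
  assumes "\<phi> \<in> lower_tests M p T \<Theta>\<^sub>0 \<Theta>\<^sub>1 h"
  obtains c \<gamma> where "\<gamma> \<in> {0..1}" "\<phi> = lower c \<gamma>"
    "\<And>\<omega>. \<omega> \<in> space M \<Longrightarrow> T \<omega> \<in> Di - Ds \<Longrightarrow> \<phi> \<omega> = 1"
proof -
  obtain c \<gamma> where *: "\<gamma> \<in> {0..1}" "\<phi> = lower c \<gamma>"
    "\<forall>\<omega>\<in>space M. indicator (Di - Ds) (T \<omega>) \<le> \<phi> \<omega>"
    using assms unfolding lower_tests_def Let_def step_def by blast
  have "\<phi> \<omega> = 1" if "\<omega> \<in> space M" "T \<omega> \<in> Di - Ds" for \<omega>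
    using *(3)[rule_format, OF that(1)] that(2) step_bounds[OF *(1), of c "K (T \<omega>)"] by (simp add: *(2))
  then show ?thesis by (rule that[OF *(1,2)])
qed

lemma lower_testsI:
  assumes "\<gamma> \<in> {0..1}" "\<And>\<omega>. \<omega> \<in> space M \<Longrightarrow> T \<omega> \<in> Di - Ds \<Longrightarrow> lower c \<gamma> \<omega> = 1"
  shows "lower c \<gamma> \<in> lower_tests M p T \<Theta>\<^sub>0 \<Theta>\<^sub>1 h"
proof -
  have "indicator (Di - Ds) (T \<omega>) \<le> lower c \<gamma> \<omega>" if "\<omega> \<in> space M" for \<omega>
    using assms(2)[OF that] step_bounds[OF assms(1), of c "K (T \<omega>)"] by (auto simp: indicator_def)
  then show ?thesis using assms(1) unfolding lower_tests_def Let_def step_def by blast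
qed

text \<open>The critical value of the likelihood ratio is the supremum of \<open>h \<theta>\<^sub>0 \<theta>'\<close> over \<open>{K \<le> c}\<close>;
  since \<open>K\<close> is at least as fine as \<open>h \<theta>\<^sub>0 \<theta>'\<close>, the test can only randomize where the ratio is critical.\<close>

lemma lower_tests_unif_most_powerful:
  assumes "\<phi> \<in> lower_tests M p T \<Theta>\<^sub>0 \<Theta>\<^sub>1 h"
  shows "unif_most_powerful M p \<Theta>\<^sub>0 \<Theta>\<^sub>1 \<phi>"
proof -
  obtain c \<gamma> where \<gamma>: "\<gamma> \<in> {0..1}" and \<phi>: "\<phi> = lower c \<gamma>"
    and one: "\<And>\<omega>. \<omega> \<in> space M \<Longrightarrow> T \<omega> \<in> Di - Ds \<Longrightarrow> \<phi> \<omega> = 1"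
    using assms by (rule lower_testsE) (rule that)
  have test: "is_test M \<phi>" unfolding \<phi> using \<gamma> by (rule is_test_lower)
  have "E \<theta>' \<psi> \<le> E \<theta>' \<phi>"
    if \<psi>: "is_test M \<psi>" and le: "level M p \<Theta>\<^sub>0 \<psi> \<le> level M p \<Theta>\<^sub>0 \<phi>" and \<theta>': "\<theta>' \<in> \<Theta>\<^sub>1" for \<psi> \<theta>'
  proof -
    define k where "k = (SUP x\<in>{x. K x \<le> c}. h \<theta>\<^sub>0 \<theta>' x)"
    show ?thesis
    proof (rule neyman_pearson[OF model _ _ test \<psi>, where k = k])
      \<comment> \<open>The level of \<open>\<phi>\<close> is attained at
        \<open>\<theta>\<^sub>0\<close>, which reduces the composite null hypothesis to a simple
        one.\<close>
      show "E \<theta>\<^sub>0 \<psi> \<le> E \<theta>\<^sub>0 \<phi>"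
        using integral_law_le_level[OF model _ \<psi> \<theta>\<^sub>0_in] le level_lower[OF \<gamma>] \<phi> by simp
    next
      fix \<omega> assume \<omega>: "\<omega> \<in> space M" "p \<theta>\<^sub>0 \<omega> \<noteq> 0 \<or> p \<theta>' \<omega> \<noteq> 0"
      note ratio = h_ratio[OF \<theta>\<^sub>0_in \<theta>' \<omega>]
      {
        assume "ennreal (p \<theta>\<^sub>0 \<omega>) / ennreal (p \<theta>' \<omega>) < k \<or> p \<theta>\<^sub>0 \<omega> = 0"
        then show "\<phi> \<omega> = 1"
        proof
          assume "ennreal (p \<theta>\<^sub>0 \<omega>) / ennreal (p \<theta>' \<omega>) < k"
          then obtain x where "K x \<le> c" "h \<theta>\<^sub>0 \<theta>' (T \<omega>) < h \<theta>\<^sub>0 \<theta>' x"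
            unfolding ratio k_def less_SUP_iff by auto
          then have "K (T \<omega>) < c" using K_less_if_h_less[OF \<theta>\<^sub>0_in \<theta>'] by (meson order_less_le_trans)
          then show ?thesis by (simp add: \<phi> step_def)
        next
          assume "p \<theta>\<^sub>0 \<omega> = 0"
          then have "T \<omega> \<in> Di - Ds"
            using ratio \<omega> density_nonneg[of \<theta>' \<omega>] \<theta>' h_eq_0_iff[OF \<theta>', of "T \<omega>"] by (simp add: ennreal_ratio)
          then show ?thesis using one \<omega> by blast
        qed
      }
      {
        assume "k < ennreal (p \<theta>\<^sub>0 \<omega>) / ennreal (p \<theta>' \<omega>)"
        then have "\<not> K (T \<omega>) \<le> c"
          unfolding ratio k_def by (metis SUP_upper leD mem_Collect_eq)
        then show "\<phi> \<omega> = 0" by (auto simp: \<phi> step_def)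
      }
    qed (use \<theta>\<^sub>0_in \<theta>' in auto)
  qed
  with test show ?thesis by (simp add: unif_most_powerful_def)
qed

section \<open>Minimal rejection levels\<close>

lemma step_le_if_rejects:
  assumes "\<gamma> \<in> {0..1}"
  shows "step c \<gamma> k = 1 \<Longrightarrow> step k 1 x \<le> step c \<gamma> x" "0 < step c \<gamma> k \<Longrightarrow> step k 0 x \<le> step c \<gamma> x"
  using assms by (auto simp: step_def split: if_splits)

text \<open>With k = K(T(\<omega>)), every test that surely rejects at \<omega> dominates
  \<open>lower k 1\<close>, itself such a test. Every test that possibly rejects dominates
  \<open>lower k 0\<close>, which does not reject at \<omega> but is approached by
  \<open>lower k e\<close> at an extra level of at most e.\<close>

lemma halfway_level_lower:
  assumes \<omega>: "\<omega> \<in> space M" "T \<omega> \<notin> Di - Ds"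
  shows "halfway_level M p \<Theta>\<^sub>0 (lower_tests M p T \<Theta>\<^sub>0 \<Theta>\<^sub>1 h) \<omega> = mean_cdf M p (K \<circ> T) \<theta>\<^sub>0 (K (T \<omega>))"
proof -
  let ?t = "lower_tests M p T \<Theta>\<^sub>0 \<Theta>\<^sub>1 h" and ?k = "K (T \<omega>)"
  have \<theta>\<^sub>0: "\<theta>\<^sub>0 \<in> \<Theta>\<^sub>0 \<union> \<Theta>\<^sub>1" using \<theta>\<^sub>0_in by simp
  have mem: "lower ?k \<gamma> \<in> ?t" if "\<gamma> \<in> {0..1}" for \<gamma>
    using that K_less_from_Di[OF _ \<omega>(2)] by (intro lower_testsI) (auto simp: step_def)
  have "Inf (level M p \<Theta>\<^sub>0 ` {\<phi>\<in>?t. \<phi> \<omega> = 1}) = E \<theta>\<^sub>0 (lower ?k 1)"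
  proof (rule cInf_eq_minimum)
    show "E \<theta>\<^sub>0 (lower ?k 1) \<in> level M p \<Theta>\<^sub>0 ` {\<phi>\<in>?t. \<phi> \<omega> = 1}"
      using mem[of 1] by (intro image_eqI[of _ _ "lower ?k 1"]) (simp_all add: level_lower, simp add: step_def)
  next
    fix x assume "x \<in> level M p \<Theta>\<^sub>0 ` {\<phi>\<in>?t. \<phi> \<omega> = 1}"
    then obtain \<phi> where \<phi>: "\<phi> \<in> ?t" "\<phi> \<omega> = 1" "x = level M p \<Theta>\<^sub>0 \<phi>" by auto
    obtain c \<gamma> where "\<gamma> \<in> {0..1}" "\<phi> = lower c \<gamma>" using \<phi>(1) by (rule lower_testsE)
    then show "E \<theta>\<^sub>0 (lower ?k 1) \<le> x"
      using \<phi>(2) unfolding \<phi>(3)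
      by (auto simp: level_lower intro!: integral_law_mono[OF model \<theta>\<^sub>0] is_test_lower step_le_if_rejects)
  qed
  moreover have "Inf (level M p \<Theta>\<^sub>0 ` {\<phi>\<in>?t. 0 < \<phi> \<omega>}) = E \<theta>\<^sub>0 (lower ?k 0)"
  proof (rule cInf_eq_approx)
    fix e :: real assume e: "0 < e" "e \<le> 1"
    interpret prob_space "law M p \<theta>\<^sub>0" using model \<theta>\<^sub>0 by (rule prob_space_law)
    have "level M p \<Theta>\<^sub>0 (lower ?k e) \<le> E \<theta>\<^sub>0 (lower ?k 0) + e"
      using e by (simp add: level_lower E_lower[OF \<theta>\<^sub>0] mult_left_le)
    moreover have "lower ?k e \<in> {\<phi>\<in>?t. 0 < \<phi> \<omega>}"
      using mem[of e] e by (simp, simp add: step_def)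
    ultimately show "\<exists>x\<in>level M p \<Theta>\<^sub>0 ` {\<phi>\<in>?t. 0 < \<phi> \<omega>}. x \<le> E \<theta>\<^sub>0 (lower ?k 0) + e" by blast
  next
    fix x assume "x \<in> level M p \<Theta>\<^sub>0 ` {\<phi>\<in>?t. 0 < \<phi> \<omega>}"
    then obtain \<phi> where \<phi>: "\<phi> \<in> ?t" "0 < \<phi> \<omega>" "x = level M p \<Theta>\<^sub>0 \<phi>" by auto
    obtain c \<gamma> where "\<gamma> \<in> {0..1}" "\<phi> = lower c \<gamma>" using \<phi>(1) by (rule lower_testsE)
    then show "E \<theta>\<^sub>0 (lower ?k 0) \<le> x"
      using \<phi>(2) unfolding \<phi>(3)
      by (auto simp: level_lower intro!: integral_law_mono[OF model \<theta>\<^sub>0] is_test_lower step_le_if_rejects)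
  qed
  ultimately show ?thesis by (simp add: halfway_level_def mean_cdf_eq[OF \<theta>\<^sub>0] add.commute)
qed

text \<open>Randomizing at K(T(\<omega>)) would violate the mandatory rejection on
  \<open>Di - Ds\<close>. The test \<open>lower (K (T \<omega>)) 1\<close> rejects exactly there,
  where \<open>p \<theta>\<^sub>0\<close> vanishes, so level 0 is attained in both infima.\<close>

lemma halfway_level_lower_Di:
  assumes \<omega>: "\<omega> \<in> space M" "T \<omega> \<in> Di - Ds"
  shows "halfway_level M p \<Theta>\<^sub>0 (lower_tests M p T \<Theta>\<^sub>0 \<Theta>\<^sub>1 h) \<omega> = 0"
proof -
  let ?t = "lower_tests M p T \<Theta>\<^sub>0 \<Theta>\<^sub>1 h" and ?\<phi> = "lower (K (T \<omega>)) 1"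
  have \<theta>\<^sub>0: "\<theta>\<^sub>0 \<in> \<Theta>\<^sub>0 \<union> \<Theta>\<^sub>1" using \<theta>\<^sub>0_in by simp
  have mem: "?\<phi> \<in> ?t"
    using K_const_Di[OF \<omega>(2)] by (intro lower_testsI) (auto simp: step_def)
  have "p \<theta>\<^sub>0 \<omega>' * ?\<phi> \<omega>' = 0" if "\<omega>' \<in> space M" for \<omega>'
  proof (cases "T \<omega>' \<in> Di - Ds")
    case True
    then show ?thesis using density_zero_Di[OF \<theta>\<^sub>0_in that] by simp
  next
    case False
    then have "K (T \<omega>) < K (T \<omega>')" by (rule K_less_from_Di[OF \<omega>(2)])
    then show ?thesis by (auto simp: step_def)
  qed
  then have "(\<integral>\<omega>'. p \<theta>\<^sub>0 \<omega>' * ?\<phi> \<omega>' \<partial>M) = (\<integral>\<omega>'. 0 \<partial>M)" by (intro Bochner_Integration.integral_cong) auto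
  then have "E \<theta>\<^sub>0 ?\<phi> = 0"
    using is_test_lower[of 1] by (subst integral_law[OF model \<theta>\<^sub>0]) (auto simp: is_test_def)
  then have level: "level M p \<Theta>\<^sub>0 ?\<phi> = 0" by (simp add: level_lower)
  have nonneg: "0 \<le> level M p \<Theta>\<^sub>0 \<phi>" if "\<phi> \<in> ?t" for \<phi>
    using that by (rule lower_testsE) (simp add: level_lower integral_law_test_bounds[OF model \<theta>\<^sub>0] is_test_lower)
  have "?\<phi> \<omega> = 1" by (simp add: step_def)
  with mem level nonneg have "Inf (level M p \<Theta>\<^sub>0 ` {\<phi>\<in>?t. \<phi> \<omega> = 1}) = 0"
    "Inf (level M p \<Theta>\<^sub>0 ` {\<phi>\<in>?t. 0 < \<phi> \<omega>}) = 0"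
    by (intro cInf_eq_minimum; force)+
  then show ?thesis by (simp add: halfway_level_def)
qed

lemma upper_tests_eq: "upper_tests T \<Theta>\<^sub>0 \<Theta>\<^sub>1 h = {\<lambda>\<omega>. 1 - lower c \<gamma> \<omega> | c \<gamma>. \<gamma> \<in> {0..1}}"
proof (intro equalityI subsetI)
  have eq: "(\<lambda>\<omega>. if K (T \<omega>) > c then 1 else if K (T \<omega>) = c then \<gamma> else 0) = (\<lambda>\<omega>. 1 - lower c (1 - \<gamma>) \<omega>)"
    if "\<gamma> \<in> {0..1}" for c \<gamma> using upper_step[OF that] by blast
  {
    fix \<phi> assume "\<phi> \<in> upper_tests T \<Theta>\<^sub>0 \<Theta>\<^sub>1 h"
    then obtain c \<gamma> where "\<gamma> \<in> {0..1}"
      "\<phi> = (\<lambda>\<omega>. if K (T \<omega>) > c then 1 else if K (T \<omega>) = c then \<gamma> else 0)"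
      unfolding upper_tests_def Let_def by blast
    then show "\<phi> \<in> {\<lambda>\<omega>. 1 - lower c \<gamma> \<omega> | c \<gamma>. \<gamma> \<in> {0..1}}"
      using eq[of \<gamma> c] by (intro CollectI exI[of _ c] exI[of _ "1 - \<gamma>"]) simp
  }
  {
    fix \<phi> assume "\<phi> \<in> {\<lambda>\<omega>. 1 - lower c \<gamma> \<omega> | c \<gamma>. \<gamma> \<in> {0..1}}"
    then obtain c \<gamma> where *: "\<gamma> \<in> {0..1}" "\<phi> = (\<lambda>\<omega>. 1 - lower c \<gamma> \<omega>)" by blast
    then show "\<phi> \<in> upper_tests T \<Theta>\<^sub>0 \<Theta>\<^sub>1 h"
      using eq[of "1 - \<gamma>" c] unfolding upper_tests_def Let_def
      by (intro CollectI exI[of _ c] bexI[of _ "1 - \<gamma>"]) simp_all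
  }
qed

lemma bdd_above_upper:
  assumes "\<gamma> \<in> {0..1}"
  shows "bdd_above ((\<lambda>\<theta>. 1 - E \<theta> (lower c \<gamma>)) ` \<Theta>\<^sub>1)"
  using integral_law_test_bounds(1)[OF model _ is_test_lower[OF assms]]
  by (intro bdd_aboveI2[where M = 1]) auto

lemma mean_cdf_bounds:
  assumes "\<theta> \<in> \<Theta>\<^sub>0 \<union> \<Theta>\<^sub>1"
  shows "0 \<le> mean_cdf M p (K \<circ> T) \<theta> c" "mean_cdf M p (K \<circ> T) \<theta> c \<le> 1"
  using integral_law_test_bounds[OF model assms is_test_lower[of 0 c]]
    integral_law_test_bounds[OF model assms is_test_lower[of 1 c]]
  by (simp_all add: mean_cdf_eq[OF assms])

lemma mean_cdf_antimono:
  assumes "\<theta> \<in> \<Theta>\<^sub>0 \<union> \<Theta>\<^sub>1" "\<theta>' \<in> \<Theta>\<^sub>0 \<union> \<Theta>\<^sub>1" "\<theta> \<le> \<theta>'"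
  shows "mean_cdf M p (K \<circ> T) \<theta>' c \<le> mean_cdf M p (K \<circ> T) \<theta> c"
  using E_lower_antimono[OF _ assms, of 0 c] E_lower_antimono[OF _ assms, of 1 c]
  by (simp add: mean_cdf_eq[OF assms(1)] mean_cdf_eq[OF assms(2)])

lemma bdd_above_vote: "bdd_above ((\<lambda>\<theta>. 1 - mean_cdf M p (K \<circ> T) \<theta> c) ` \<Theta>\<^sub>1)"
  using mean_cdf_bounds(1) by (intro bdd_aboveI2[where M = 1]) auto

lemma vote_mono: "mono_on \<Theta>\<^sub>1 (\<lambda>\<theta>. 1 - mean_cdf M p (K \<circ> T) \<theta> c)"
  by (intro mono_onI) (auto intro: mean_cdf_antimono)

text \<open>The mirror image of the lower case: complements of \<open>lower k 0\<close> and
  \<open>lower k 1\<close> are the extreme tests. Each infimum is now a supremum over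
  \<open>\<Theta>\<^sub>1\<close>, and both suprema are of functions increasing in \<theta>, so
  their mean is the supremum of the mean.\<close>

lemma halfway_level_upper:
  assumes \<omega>: "\<omega> \<in> space M"
  shows "halfway_level M p \<Theta>\<^sub>1 (upper_tests T \<Theta>\<^sub>0 \<Theta>\<^sub>1 h) \<omega>
    = (SUP \<theta>\<in>\<Theta>\<^sub>1. 1 - mean_cdf M p (K \<circ> T) \<theta> (K (T \<omega>)))"
proof -
  let ?t = "upper_tests T \<Theta>\<^sub>0 \<Theta>\<^sub>1 h" and ?k = "K (T \<omega>)"
  let ?upper = "\<lambda>c \<gamma> \<omega>. 1 - lower c \<gamma> \<omega>"
  let ?s = "\<lambda>\<gamma>. SUP \<theta>\<in>\<Theta>\<^sub>1. 1 - E \<theta> (lower ?k \<gamma>)"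
  have mem: "?upper ?k \<gamma> \<in> ?t" if "\<gamma> \<in> {0..1}" for \<gamma>
    using that unfolding upper_tests_eq by blast
  let ?q = "\<lambda>\<theta>. 1 - mean_cdf M p (K \<circ> T) \<theta> ?k"
  have step: "step c \<gamma> x \<le> step k 0 x" if "step c \<gamma> k = 0" "\<gamma> \<in> {0..1}" for c k x :: ereal and \<gamma>
    using that by (auto simp: step_def split: if_splits)
  have step': "step c \<gamma> x \<le> step k 1 x" if "step c \<gamma> k < 1" "\<gamma> \<in> {0..1}" for c k x :: ereal and \<gamma>
    using that by (auto simp: step_def split: if_splits)
  have "Inf (level M p \<Theta>\<^sub>1 ` {\<phi>\<in>?t. \<phi> \<omega> = 1}) = ?s 0"
  proof (rule cInf_eq_minimum)
    show "?s 0 \<in> level M p \<Theta>\<^sub>1 ` {\<phi>\<in>?t. \<phi> \<omega> = 1}"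
      using mem[of 0] by (intro image_eqI[of _ _ "?upper ?k 0"]) (simp_all add: level_upper, simp add: step_def)
  next
    fix x assume "x \<in> level M p \<Theta>\<^sub>1 ` {\<phi>\<in>?t. \<phi> \<omega> = 1}"
    then obtain c \<gamma> where *: "\<gamma> \<in> {0..1}" "lower c \<gamma> \<omega> = 0" "x = level M p \<Theta>\<^sub>1 (?upper c \<gamma>)"
      by (auto simp: upper_tests_eq)
    have "level M p \<Theta>\<^sub>1 (?upper ?k 0) \<le> x"
      unfolding *(3) using * \<Theta>\<^sub>1_nonempty
      by (intro level_mono[OF model] is_test_upper) (auto intro!: step)
    then show "?s 0 \<le> x" by (simp add: level_upper)
  qed
  moreover have "Inf (level M p \<Theta>\<^sub>1 ` {\<phi>\<in>?t. 0 < \<phi> \<omega>}) = ?s 1"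
  proof (rule cInf_eq_approx)
    fix e :: real assume e: "0 < e" "e \<le> 1"
    \<comment> \<open>Randomized rejection with probability e at the critical value costs at most e
      under each \<theta>; being uniform, the bound passes to the supremum.\<close>
    have "1 - E \<theta> (lower ?k (1 - e)) \<le> ?s 1 + e" if \<theta>: "\<theta> \<in> \<Theta>\<^sub>1" for \<theta>
    proof -
      interpret prob_space "law M p \<theta>" using \<theta> by (intro prob_space_law[OF model]) simp
      have "e * measure (law M p \<theta>) {\<omega>' \<in> space M. K (T \<omega>') = ?k} \<le> e"
        using e by (intro mult_left_le) auto
      then have "1 - E \<theta> (lower ?k (1 - e)) \<le> 1 - E \<theta> (lower ?k 1) + e"
        using \<theta> by (simp add: E_lower algebra_simps)
      also have "\<dots> \<le> ?s 1 + e" using \<theta> by (intro add_right_mono cSUP_upper bdd_above_upper) auto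
      finally show ?thesis .
    qed
    then have "level M p \<Theta>\<^sub>1 (?upper ?k (1 - e)) \<le> ?s 1 + e"
      using e \<Theta>\<^sub>1_nonempty by (simp add: level_upper cSUP_least)
    moreover have "?upper ?k (1 - e) \<in> {\<phi>\<in>?t. 0 < \<phi> \<omega>}"
      using mem[of "1 - e"] e by (simp, simp add: step_def)
    ultimately show "\<exists>x\<in>level M p \<Theta>\<^sub>1 ` {\<phi>\<in>?t. 0 < \<phi> \<omega>}. x \<le> ?s 1 + e" by blast
  next
    fix x assume "x \<in> level M p \<Theta>\<^sub>1 ` {\<phi>\<in>?t. 0 < \<phi> \<omega>}"
    then obtain c \<gamma> where *: "\<gamma> \<in> {0..1}" "lower c \<gamma> \<omega> < 1" "x = level M p \<Theta>\<^sub>1 (?upper c \<gamma>)"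
      by (auto simp: upper_tests_eq)
    have "level M p \<Theta>\<^sub>1 (?upper ?k 1) \<le> x"
      unfolding *(3) using * \<Theta>\<^sub>1_nonempty
      by (intro level_mono[OF model] is_test_upper) (auto intro!: step')
    then show "?s 1 \<le> x" by (simp add: level_upper)
  qed
  moreover have "?s 0 + ?s 1 = (SUP \<theta>\<in>\<Theta>\<^sub>1. (1 - E \<theta> (lower ?k 0)) + (1 - E \<theta> (lower ?k 1)))"
    using \<Theta>\<^sub>1_nonempty
    by (intro SUP_add_directed[symmetric] bdd_above_upper)
      (auto intro!: mono_onI E_lower_antimono)
  moreover have "\<dots> = (SUP \<theta>\<in>\<Theta>\<^sub>1. ?q \<theta> + ?q \<theta>)"
    by (intro SUP_cong) (auto simp: mean_cdf_eq field_simps)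
  \<comment> \<open>Applied to \<open>?q\<close> twice, additivity takes the factor 2 out of the
    supremum; the division by 2 in \<open>halfway_level\<close> cancels it.\<close>
  moreover have "\<dots> = (SUP \<theta>\<in>\<Theta>\<^sub>1. ?q \<theta>) + (SUP \<theta>\<in>\<Theta>\<^sub>1. ?q \<theta>)"
    using \<Theta>\<^sub>1_nonempty vote_mono[of ?k] bdd_above_vote[of ?k] by (intro SUP_add_directed)
  ultimately show ?thesis unfolding halfway_level_def by simp
qed

text \<open>By \<open>K_ge_Ds\<close>, a value of \<open>K\<close> at least K(T(\<omega>)) forces T
  into \<open>Ds\<close>, where the densities of \<open>\<Theta>\<^sub>1\<close> vanish. The mean
  distribution function is therefore 1: the level 0 on \<open>Ds\<close> is computed, not a
  convention.\<close>

lemma halfway_level_upper_Ds: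
  assumes \<omega>: "\<omega> \<in> space M" "T \<omega> \<in> Ds"
  shows "halfway_level M p \<Theta>\<^sub>1 (upper_tests T \<Theta>\<^sub>0 \<Theta>\<^sub>1 h) \<omega> = 0"
proof -
  have "mean_cdf M p (K \<circ> T) \<theta> (K (T \<omega>)) = 1" if \<theta>: "\<theta> \<in> \<Theta>\<^sub>1" for \<theta>
  proof -
    have \<theta>': "\<theta> \<in> \<Theta>\<^sub>0 \<union> \<Theta>\<^sub>1" using \<theta> by simp
    have null: "p \<theta> \<omega>' * (1 - lower (K (T \<omega>)) \<gamma> \<omega>') = 0" if "\<omega>' \<in> space M" for \<omega>' \<gamma>
      using density_zero_Ds[OF \<theta> that] K_ge_Ds[OF \<omega>(2), of "T \<omega>'"] by (auto simp: step_def not_less)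
    have "1 - E \<theta> (lower (K (T \<omega>)) \<gamma>) = 0" if "\<gamma> \<in> {0..1}" for \<gamma>
    proof -
      have "(\<integral>\<omega>'. p \<theta> \<omega>' * (1 - lower (K (T \<omega>)) \<gamma> \<omega>') \<partial>M) = (\<integral>\<omega>'. 0 \<partial>M)"
        using null by (intro Bochner_Integration.integral_cong) auto
      then show ?thesis
        using is_test_upper[OF that]
        by (simp add: E_upper[OF that \<theta>', symmetric] integral_law[OF model \<theta>'] is_test_def)
    qed
    from this[of 0] this[of 1] show ?thesis by (simp add: mean_cdf_eq[OF \<theta>'])
  qed
  then show ?thesis using \<Theta>\<^sub>1_nonempty by (simp add: halfway_level_upper[OF \<omega>(1)])
qed

section \<open>Votes and most favourable votes\<close>

lemma
  assumes "\<theta> \<in> \<Theta>\<^sub>0 \<union> \<Theta>\<^sub>1"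
  shows pmf_vote_True: "pmf (vote M p T \<Theta>\<^sub>0 \<Theta>\<^sub>1 h \<theta> \<omega>) True =
      (if T \<omega> \<in> Ds then 0 else if T \<omega> \<in> Di then 1 else 1 - mean_cdf M p (K \<circ> T) \<theta> (K (T \<omega>)))"
    and pmf_vote_False: "pmf (vote M p T \<Theta>\<^sub>0 \<Theta>\<^sub>1 h \<theta> \<omega>) False =
      (if T \<omega> \<in> Ds then 1 else if T \<omega> \<in> Di then 0 else mean_cdf M p (K \<circ> T) \<theta> (K (T \<omega>)))"
  \<comment> \<open>The parameter of \<open>bernoulli_pmf\<close> is the weight of
    \<open>True\<close> only when it lies in [0, 1].\<close>
  using mean_cdf_bounds[OF assms] by (auto simp: vote_def Let_def)

text \<open>The mean distribution function decreases in \<theta>, so the supremum is attained at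
  \<open>\<theta>\<^sub>0\<close>. Equality of whole distributions lets adjacency be rewritten
  directly as an equation for the vote of \<open>\<theta>\<^sub>0\<close>.\<close>

lemma most_favourable_0_eq_vote: "most_favourable_0 M p T \<Theta>\<^sub>0 \<Theta>\<^sub>1 h \<omega> = vote M p T \<Theta>\<^sub>0 \<Theta>\<^sub>1 h \<theta>\<^sub>0 \<omega>"
proof -
  let ?v = "\<lambda>\<theta>. vote M p T \<Theta>\<^sub>0 \<Theta>\<^sub>1 h \<theta> \<omega>"
  have "(SUP \<theta>\<in>\<Theta>\<^sub>0. pmf (?v \<theta>) False) = pmf (?v \<theta>\<^sub>0) False"
    using \<theta>\<^sub>0_in \<theta>\<^sub>0_least by (intro cSup_eq_maximum) (auto simp: pmf_vote_False mean_cdf_antimono)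
  then have "most_favourable_0 M p T \<Theta>\<^sub>0 \<Theta>\<^sub>1 h \<omega> = bernoulli_pmf (pmf (?v \<theta>\<^sub>0) True)"
    using \<theta>\<^sub>0_in by (auto simp: most_favourable_0_def pmf_vote_True pmf_vote_False)
  also have "\<dots> = ?v \<theta>\<^sub>0"
    using \<theta>\<^sub>0_in mean_cdf_bounds[of \<theta>\<^sub>0] by (auto simp: vote_def Let_def)
  finally show ?thesis .
qed

lemma pmf_vote_eq_min_rejection_level:
  assumes "\<omega> \<in> space M"
  shows "pmf (vote M p T \<Theta>\<^sub>0 \<Theta>\<^sub>1 h \<theta>\<^sub>0 \<omega>) False = min_rejection_level M p T \<Theta>\<^sub>0 \<Theta>\<^sub>1 h \<omega>"
proof -
  have "\<theta>\<^sub>0 \<in> \<Theta>\<^sub>0 \<union> \<Theta>\<^sub>1" using \<theta>\<^sub>0_in by simp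
  note vote = pmf_vote_False[OF this, of \<omega>]
  consider "T \<omega> \<in> Ds" | "T \<omega> \<in> Di - Ds" | "T \<omega> \<notin> Di" "T \<omega> \<notin> Ds" by blast
  then show ?thesis
    by cases (simp_all add: vote min_rejection_level_def halfway_level_lower[OF assms] halfway_level_lower_Di[OF assms])
qed

lemma pmf_most_favourable_1:
  "pmf (most_favourable_1 M p T \<Theta>\<^sub>0 \<Theta>\<^sub>1 h \<omega>) True =
    (if T \<omega> \<in> Ds then 0 else if T \<omega> \<in> Di then 1
     else (SUP \<theta>\<in>\<Theta>\<^sub>1. 1 - mean_cdf M p (K \<circ> T) \<theta> (K (T \<omega>))))"
proof -
  let ?s = "SUP \<theta>\<in>\<Theta>\<^sub>1. pmf (vote M p T \<Theta>\<^sub>0 \<Theta>\<^sub>1 h \<theta> \<omega>) True"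
  obtain \<theta> where \<theta>: "\<theta> \<in> \<Theta>\<^sub>1" using \<Theta>\<^sub>1_nonempty by blast
  have "0 \<le> pmf (vote M p T \<Theta>\<^sub>0 \<Theta>\<^sub>1 h \<theta> \<omega>) True" by simp
  also have "\<dots> \<le> ?s"
    using \<theta> by (intro cSUP_upper bdd_aboveI2[where M = 1]) (auto simp: pmf_le_1)
  finally have "0 \<le> ?s" .
  moreover have "?s \<le> 1" using \<theta> by (intro cSUP_least) (auto simp: pmf_le_1)
  ultimately have "pmf (most_favourable_1 M p T \<Theta>\<^sub>0 \<Theta>\<^sub>1 h \<omega>) True = ?s"
    by (simp add: most_favourable_1_def)
  \<comment> \<open>The case distinction does not involve \<theta>, so the supremum over the
    nonempty \<open>\<Theta>\<^sub>1\<close> passes through it.\<close>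
  also have "?s = (SUP \<theta>\<in>\<Theta>\<^sub>1. if T \<omega> \<in> Ds then 0 else if T \<omega> \<in> Di then 1
      else 1 - mean_cdf M p (K \<circ> T) \<theta> (K (T \<omega>)))"
    by (intro SUP_cong) (auto simp: pmf_vote_True)
  finally show ?thesis using \<Theta>\<^sub>1_nonempty by auto
qed

lemma pmf_most_favourable_1_eq_min_rejection_level':
  assumes "\<omega> \<in> space M"
  shows "pmf (most_favourable_1 M p T \<Theta>\<^sub>0 \<Theta>\<^sub>1 h \<omega>) True = min_rejection_level' M p T \<Theta>\<^sub>0 \<Theta>\<^sub>1 h \<omega>"
proof -
  consider "T \<omega> \<in> Ds" | "T \<omega> \<in> Di - Ds" | "T \<omega> \<notin> Di" "T \<omega> \<notin> Ds" by blast
  then show ?thesis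
  proof cases
    case 1
    then show ?thesis
      by (simp add: pmf_most_favourable_1 min_rejection_level'_def halfway_level_upper_Ds[OF assms])
  qed (simp_all add: pmf_most_favourable_1 min_rejection_level'_def halfway_level_upper[OF assms])
qed

end

theorem proposition5p1p1:
  fixes M :: "'a measure" and \<Theta> :: "real set" and p :: "real \<Rightarrow> 'a \<Rightarrow> real"
    and T :: "'a \<Rightarrow> real" and h :: "real \<Rightarrow> real \<Rightarrow> real \<Rightarrow> ennreal" and \<theta>\<^sub>0 :: real
  defines "\<Theta>\<^sub>0 \<equiv> \<Theta> \<inter> {\<theta>. \<theta> \<ge> \<theta>\<^sub>0}" and "\<Theta>\<^sub>1 \<equiv> \<Theta> \<inter> {\<theta>. \<theta> < \<theta>\<^sub>0}"
  defines "K \<equiv> essential \<Theta>\<^sub>0 \<Theta>\<^sub>1 h"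
    and "Di \<equiv> D_inf M p T \<Theta>\<^sub>0" and "Ds \<equiv> D_sup M p T \<Theta>\<^sub>1"
    and "Q \<equiv> vote M p T \<Theta>\<^sub>0 \<Theta>\<^sub>1 h"
    and "Q\<^sub>0 \<equiv> most_favourable_0 M p T \<Theta>\<^sub>0 \<Theta>\<^sub>1 h"
    and "Q\<^sub>1 \<equiv> most_favourable_1 M p T \<Theta>\<^sub>0 \<Theta>\<^sub>1 h"
    and "\<alpha> \<equiv> min_rejection_level M p T \<Theta>\<^sub>0 \<Theta>\<^sub>1 h"
    and "\<alpha>' \<equiv> min_rejection_level' M p T \<Theta>\<^sub>0 \<Theta>\<^sub>1 h"
  assumes "stat_model M \<Theta> p"
    and "monotone_likelihood_ratio M \<Theta> p T"
    and "\<theta>\<^sub>0 \<in> \<Theta>" and "ereal \<theta>\<^sub>0 \<noteq> (INF \<theta>\<in>\<Theta>. ereal \<theta>)"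
    and "normalized_family M p T \<Theta>\<^sub>0 \<Theta>\<^sub>1 h"
  shows "(\<forall>\<phi>\<in>lower_tests M p T \<Theta>\<^sub>0 \<Theta>\<^sub>1 h. unif_most_powerful M p \<Theta>\<^sub>0 \<Theta>\<^sub>1 \<phi>) \<and>
    (\<forall>\<omega>\<in>space M.
       pmf (Q\<^sub>0 \<omega>) False = pmf (Q \<theta>\<^sub>0 \<omega>) False \<and>
       pmf (Q\<^sub>0 \<omega>) False = \<alpha> \<omega> \<and>
       \<alpha> \<omega> = (if T \<omega> \<in> Ds then 1 else if T \<omega> \<in> Di then 0
              else measure (law M p \<theta>\<^sub>0) {\<omega>'\<in>space M. K (T \<omega>') < K (T \<omega>)}
                   + 1/2 * measure (law M p \<theta>\<^sub>0) {\<omega>'\<in>space M. K (T \<omega>') = K (T \<omega>)})) \<and>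
    (almost_surely M \<Theta> p (\<lambda>\<omega>. Q\<^sub>0 \<omega> = Q\<^sub>1 \<omega>) \<longrightarrow>
       almost_surely M \<Theta> p (\<lambda>\<omega>. pmf (Q\<^sub>1 \<omega>) True = pmf (Q \<theta>\<^sub>0 \<omega>) True) \<and>
       (\<forall>\<omega>\<in>space M.
          pmf (Q\<^sub>1 \<omega>) True = \<alpha>' \<omega> \<and>
          \<alpha>' \<omega> = (if T \<omega> \<in> Ds then 0 else if T \<omega> \<in> Di then 1
                  else (SUP \<theta>\<in>\<Theta>\<^sub>1. 1 - mean_cdf M p (K \<circ> T) \<theta> (K (T \<omega>))))))"
proof -
  have split: "\<Theta>\<^sub>0 \<union> \<Theta>\<^sub>1 = \<Theta>" by (auto simp: \<Theta>\<^sub>0_def \<Theta>\<^sub>1_def)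
  \<comment> \<open>Otherwise \<open>\<theta>\<^sub>0\<close> would be the minimum of
    \<open>\<Theta>\<close>, hence its infimum; taken in \<open>ereal\<close>, the infimum exists
    also for unbounded \<open>\<Theta>\<close>.\<close>
  have "\<Theta>\<^sub>1 \<noteq> {}"
  proof
    assume "\<Theta>\<^sub>1 = {}"
    then have "(INF \<theta>\<in>\<Theta>. ereal \<theta>) = ereal \<theta>\<^sub>0"
      using \<open>\<theta>\<^sub>0 \<in> \<Theta>\<close> by (intro antisym INF_lower INF_greatest) (auto simp: \<Theta>\<^sub>1_def not_less)
    with \<open>ereal \<theta>\<^sub>0 \<noteq> (INF \<theta>\<in>\<Theta>. ereal \<theta>)\<close> show False by simp
  qed
  then interpret one_sided_mlr M \<Theta>\<^sub>0 \<Theta>\<^sub>1 p T h \<theta>\<^sub>0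
    using assms(11-13,15) split by unfold_locales (auto simp: \<Theta>\<^sub>0_def)
  have \<theta>\<^sub>0: "\<theta>\<^sub>0 \<in> \<Theta>\<^sub>0 \<union> \<Theta>\<^sub>1" using \<theta>\<^sub>0_in by simp
  have Q\<^sub>0: "Q\<^sub>0 \<omega> = Q \<theta>\<^sub>0 \<omega>" for \<omega>
    unfolding Q\<^sub>0_def Q_def by (rule most_favourable_0_eq_vote)
  have \<alpha>: "pmf (Q \<theta>\<^sub>0 \<omega>) False = \<alpha> \<omega>" if "\<omega> \<in> space M" for \<omega>
    unfolding Q_def \<alpha>_def using that by (rule pmf_vote_eq_min_rejection_level)
  \<comment> \<open>Averaging the tests with randomization 0 and 1 gives the event K(T) =
    K(T(\<omega>)) the weight 1/2.\<close>
  have "\<alpha> \<omega> = (if T \<omega> \<in> Ds then 1 else if T \<omega> \<in> Di then 0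
      else measure (law M p \<theta>\<^sub>0) {\<omega>'\<in>space M. K (T \<omega>') < K (T \<omega>)}
           + 1/2 * measure (law M p \<theta>\<^sub>0) {\<omega>'\<in>space M. K (T \<omega>') = K (T \<omega>)})" if "\<omega> \<in> space M" for \<omega>
    unfolding \<alpha>[OF that, symmetric] Q_def Ds_def Di_def K_def
    by (simp add: pmf_vote_False[OF \<theta>\<^sub>0] mean_cdf_eq[OF \<theta>\<^sub>0] E_lower[OF \<theta>\<^sub>0])
  \<comment> \<open>The same null event works: outside it both votes are equal as distributions, in
    particular at \<open>True\<close>.\<close>
  moreover have "almost_surely M \<Theta> p (\<lambda>\<omega>. pmf (Q\<^sub>1 \<omega>) True = pmf (Q \<theta>\<^sub>0 \<omega>) True)"
    if "almost_surely M \<Theta> p (\<lambda>\<omega>. Q\<^sub>0 \<omega> = Q\<^sub>1 \<omega>)"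
    using that unfolding almost_surely_def Q\<^sub>0 by metis
  moreover have "pmf (Q\<^sub>1 \<omega>) True = (if T \<omega> \<in> Ds then 0 else if T \<omega> \<in> Di then 1
      else (SUP \<theta>\<in>\<Theta>\<^sub>1. 1 - mean_cdf M p (K \<circ> T) \<theta> (K (T \<omega>))))" for \<omega>
    unfolding Q\<^sub>1_def Ds_def Di_def K_def by (rule pmf_most_favourable_1)
  moreover have "pmf (Q\<^sub>1 \<omega>) True = \<alpha>' \<omega>" if "\<omega> \<in> space M" for \<omega>
    unfolding Q\<^sub>1_def \<alpha>'_def using that by (rule pmf_most_favourable_1_eq_min_rejection_level')
  ultimately show ?thesis using Q\<^sub>0 \<alpha> lower_tests_unif_most_powerful by simp
qed

end
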